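(* Let $n,p\ge 1$, let $D_n$ be the $n$-th Weyl algebra over $\mathbb{C}$, let $A=\mathbb{C}[s_1,\dots,s_p]$ and let $R=D_n[s_1,\dots,s_p]$. Let $\mathfrak{J}\subset R$ be a left ideal, and let $\mathfrak{p}\subset A$ be a minimal prime divisor of the ideal $\mathfrak{J}\cap A$ of $A$. Then there exists a polynomial $h\in A\setminus\mathfrak{p}$ such that for all $\alpha\in Z(\mathfrak{p})\setminus Z(h)$, with $\mathfrak{m}_\alpha\subset A$ the maximal ideal of $\alpha$, $$\left(\frac{R}{\mathfrak{J}}\right)\otimes_{A}\left(\frac{A}{\mathfrak{m}_\alpha}\right)\neq 0.$$
   Context: $D_n=\mathbb{C}[x_1,\dots,x_n]\langle\partial_1,\dots,\partial_n\rangle$ is the Weyl algebra with $[\partial_i,x_j]=\delta_{ij}$. $R=D_n\otimes_{\mathbb{C}}\mathbb{C}[s_1,\dots,s_p]$, so the $s_i$ are central; $A$ is regarded as a subring of $R$. For an ideal $I\subset A$ (or a polynomial $h\in A$), $Z(I)$ (resp. $Z(h)$) is its zero locus in $\mathbb{C}^p$. A minimal prime divisor of an ideal $I\subset A$ is a minimal element (for inclusion) of the set of radicals of the components of a primary decomposition of $I$, equivalently a prime ideal minimal among those containing $I$. *)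

theory Defs
  imports
    Complex_Main
    "HOL-Library.Poly_Mapping"
    "HOL-Algebra.Algebra"
    "HOL-Algebra.Algebraic_Closure_Type"
begin

lemma ring_of_type_algebra_simps [simp]:
  "carrier (ring_of_type_algebra :: 'a::ring_1 ring) = UNIV"
  "x \<otimes>\<^bsub>(ring_of_type_algebra :: 'a ring)\<^esub> y = x * y"
  "\<one>\<^bsub>(ring_of_type_algebra :: 'a ring)\<^esub> = 1"
  "\<zero>\<^bsub>(ring_of_type_algebra :: 'a ring)\<^esub> = 0"
  "x \<oplus>\<^bsub>(ring_of_type_algebra :: 'a ring)\<^esub> y = x + y"
  by (simp_all add: ring_of_type_algebra_def)

lemma ring_ring_of_type_algebra: "ring (ring_of_type_algebra :: 'a::ring_1 ring)"
proof -
  have "\<exists>y. x + y = 0" for x :: 'a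
    using add.right_inverse by blast
  thus ?thesis
    unfolding ring_of_type_algebra_def using add.right_inverse
    by unfold_locales (auto simp: algebra_simps Units_def)
qed

lemma ring_of_type_algebra_a_inv [simp]:
  "\<ominus>\<^bsub>(ring_of_type_algebra :: 'a::ring_1 ring)\<^esub> x = - x"
proof -
  interpret ring "ring_of_type_algebra :: 'a ring"
    by (rule ring_ring_of_type_algebra)
  show ?thesis
    by (rule minus_equality) simp_all
qed


lemma poly_mapping_add_induct:
  assumes "\<And>k c. P (Poly_Mapping.single k c)" "\<And>f g. P f \<Longrightarrow> P g \<Longrightarrow> P (f + g)"
  shows "P (f :: 'k \<Rightarrow>\<^sub>0 'b::monoid_add)"
proof (induction f rule: update_induct)
  case const
  show ?case using assms(1)[of undefined 0] by simp
next
  case (update f a b)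
  have "Poly_Mapping.update a b f = f + Poly_Mapping.single a b"
    using update(1)
    by (intro poly_mapping_eqI) (auto simp: lookup_update lookup_add lookup_single in_keys_iff when_def)
  thus ?case using assms update by simp
qed


section \<open>The Weyl algebra\<close>

datatype 'g word = Word "'g list"

instantiation word :: (type) monoid_add
begin

definition "0 = Word []"

fun plus_word :: "'a word \<Rightarrow> 'a word \<Rightarrow> 'a word" where
  "Word u + Word v = Word (u @ v)"

instance
proof
  fix a b c :: "'a word"
  show "a + b + c = a + (b + c)" by (cases a; cases b; cases c) simp
  show "0 + a = a" by (cases a) (simp add: zero_word_def)
  show "a + 0 = a" by (cases a) (simp add: zero_word_def)
qed

end

text \<open>
  As the product of \<^typ>\<open>'a \<Rightarrow>\<^sub>0 'b\<close> is convolution, the type \<open>'g free_alg\<close> is the free associative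
  unital \<open>\<complex>\<close>-algebra on the generators \<open>'g\<close>.
\<close>

type_synonym 'g free_alg = "'g word \<Rightarrow>\<^sub>0 complex"

datatype 'n weyl_gen = Gen_x 'n | Gen_d 'n

definition free_gen :: "'g \<Rightarrow> 'g free_alg" where
  "free_gen g = Poly_Mapping.single (Word [g]) 1"

definition weyl_relators :: "'n weyl_gen free_alg set" where
  "weyl_relators =
     {free_gen (Gen_x i) * free_gen (Gen_x j) - free_gen (Gen_x j) * free_gen (Gen_x i) |i j. True} \<union>
     {free_gen (Gen_d i) * free_gen (Gen_d j) - free_gen (Gen_d j) * free_gen (Gen_d i) |i j. True} \<union>
     {free_gen (Gen_d i) * free_gen (Gen_x j) - free_gen (Gen_x j) * free_gen (Gen_d i)
        - (if i = j then 1 else 0) |i j. True}"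

text \<open>In HOL-Algebra, \<^const>\<open>genideal\<close> is the generated two-sided ideal.\<close>

definition weyl_ideal :: "'n weyl_gen free_alg set" where
  "weyl_ideal = Idl\<^bsub>ring_of_type_algebra\<^esub> weyl_relators"

lemma ideal_weyl_ideal: "ideal weyl_ideal ring_of_type_algebra"
  unfolding weyl_ideal_def
  by (rule ring.genideal_ideal[OF ring_ring_of_type_algebra]) simp

lemma weyl_relators_subset: "weyl_relators \<subseteq> weyl_ideal"
  unfolding weyl_ideal_def
  by (rule ring.genideal_self[OF ring_ring_of_type_algebra]) simp

lemma weyl_ideal_zero: "0 \<in> weyl_ideal"
  using additive_subgroup.zero_closed[OF ideal.axioms(1)[OF ideal_weyl_ideal]] by simp

lemma weyl_ideal_add: "f \<in> weyl_ideal \<Longrightarrow> g \<in> weyl_ideal \<Longrightarrow> f + g \<in> weyl_ideal"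
  using additive_subgroup.a_closed[OF ideal.axioms(1)[OF ideal_weyl_ideal], of f g] by simp

lemma weyl_ideal_mult_left: "f \<in> weyl_ideal \<Longrightarrow> g * f \<in> weyl_ideal"
  using ideal.I_l_closed[OF ideal_weyl_ideal, of f g] by simp

lemma weyl_ideal_mult_right: "f \<in> weyl_ideal \<Longrightarrow> f * g \<in> weyl_ideal"
  using ideal.I_r_closed[OF ideal_weyl_ideal, of f g] by simp

lemma weyl_ideal_uminus: "f \<in> weyl_ideal \<Longrightarrow> - f \<in> weyl_ideal"
  using weyl_ideal_mult_left[of f "-1"] by simp

definition weyl_eq :: "'n weyl_gen free_alg \<Rightarrow> 'n weyl_gen free_alg \<Rightarrow> bool" where
  "weyl_eq f g \<longleftrightarrow> f - g \<in> weyl_ideal"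

quotient_type 'n weyl = "'n weyl_gen free_alg" / weyl_eq
proof (rule equivpI)
  show "reflp (weyl_eq :: 'n weyl_gen free_alg \<Rightarrow> _)"
    by (auto simp: reflp_def weyl_eq_def weyl_ideal_zero)
  show "symp (weyl_eq :: 'n weyl_gen free_alg \<Rightarrow> _)"
    by (auto simp: symp_def weyl_eq_def dest: weyl_ideal_uminus)
  show "transp (weyl_eq :: 'n weyl_gen free_alg \<Rightarrow> _)"
    by (auto simp: transp_def weyl_eq_def dest: weyl_ideal_add)
qed

text \<open>
  Nontriviality, needed for the \<^class>\<open>ring_1\<close> instance: the free algebra acts on formal power
  series in the \<open>x\<^sub>i\<close>, given by their coefficient functions, through multiplication and partial
  differentiation, and \<^const>\<open>weyl_ideal\<close> acts by zero.
\<close>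

context
begin

private fun gen_act :: "'n weyl_gen \<Rightarrow> (('n \<Rightarrow> nat) \<Rightarrow> complex) \<Rightarrow> ('n \<Rightarrow> nat) \<Rightarrow> complex" where
  "gen_act (Gen_x i) v m = (if m i = 0 then 0 else v (m(i := m i - 1)))" |
  "gen_act (Gen_d i) v m = of_nat (Suc (m i)) * v (m(i := Suc (m i)))"

private fun word_act :: "'n weyl_gen word \<Rightarrow> (('n \<Rightarrow> nat) \<Rightarrow> complex) \<Rightarrow> ('n \<Rightarrow> nat) \<Rightarrow> complex" where
  "word_act (Word w) v = foldr gen_act w v"

private definition act :: "'n weyl_gen free_alg \<Rightarrow> (('n \<Rightarrow> nat) \<Rightarrow> complex) \<Rightarrow> ('n \<Rightarrow> nat) \<Rightarrow> complex" where
  "act f v m = (\<Sum>w\<in>Poly_Mapping.keys f. Poly_Mapping.lookup f w * word_act w v m)"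

private lemma act_superset:
  assumes "finite S" "Poly_Mapping.keys f \<subseteq> S"
  shows "act f v m = (\<Sum>w\<in>S. Poly_Mapping.lookup f w * word_act w v m)"
  unfolding act_def using assms
  by (intro sum.mono_neutral_left) (auto simp: in_keys_iff)

private lemma act_add: "act (f + g) v m = act f v m + act g v m"
proof -
  let ?S = "Poly_Mapping.keys f \<union> Poly_Mapping.keys g"
  have "Poly_Mapping.keys (f + g) \<subseteq> ?S" by (rule Poly_Mapping.keys_add)
  thus ?thesis
    by (simp add: act_superset[of ?S] lookup_add sum.distrib distrib_right)
qed

private lemma act_zero: "act 0 v m = 0"
  by (simp add: act_def)

private lemma act_diff: "act (f - g) v m = act f v m - act g v m"
  using act_add[of "f - g" g v m] by simp

private lemma act_single: "act (Poly_Mapping.single w c) v m = c * word_act w v m"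
  by (simp add: act_def)

private lemma gen_act_add: "gen_act g (\<lambda>m. u m + v m) m = gen_act g u m + gen_act g v m"
  by (cases g) (auto simp: algebra_simps)

private lemma gen_act_scale: "gen_act g (\<lambda>m. c * v m) m = c * gen_act g v m"
  by (cases g) auto

private lemma word_act_add: "word_act w (\<lambda>m. u m + v m) = (\<lambda>m. word_act w u m + word_act w v m)"
proof (cases w)
  case (Word l)
  have "foldr gen_act l (\<lambda>m. u m + v m) = (\<lambda>m. foldr gen_act l u m + foldr gen_act l v m)"
    by (induction l) (auto simp: gen_act_add)
  thus ?thesis by (simp add: Word)
qed

private lemma word_act_scale: "word_act w (\<lambda>m. c * v m) = (\<lambda>m. c * word_act w v m)"
proof (cases w)
  case (Word l)
  have "foldr gen_act l (\<lambda>m. c * v m) = (\<lambda>m. c * foldr gen_act l v m)"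
    by (induction l) (auto simp: gen_act_scale)
  thus ?thesis by (simp add: Word)
qed

private lemma word_act_plus: "word_act (w + w') v = word_act w (word_act w' v)"
  by (cases w; cases w') simp

private lemma act_linear:
  "act f (\<lambda>m. u m + v m) m = act f u m + act f v m"
  "act f (\<lambda>m. c * v m) m = c * act f v m"
  by (simp_all add: act_def word_act_add word_act_scale algebra_simps sum.distrib sum_distrib_left)

private lemma act_mult_single: "act (Poly_Mapping.single w c * g) v m = c * word_act w (act g v) m"
proof (induction g arbitrary: m rule: poly_mapping_add_induct)
  case (1 k d)
  have "act (Poly_Mapping.single k d) v = (\<lambda>m. d * word_act k v m)"
    by (rule ext) (rule act_single)
  thus ?case
    by (simp add: Poly_Mapping.mult_single act_single word_act_plus word_act_scale)
next
  case (2 f g)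
  have "act (f + g) v = (\<lambda>m. act f v m + act g v m)"
    by (rule ext) (rule act_add)
  thus ?case
    using 2 by (simp add: distrib_left act_add word_act_add)
qed

private lemma act_mult: "act (f * g) v m = act f (act g v) m"
proof (induction f rule: poly_mapping_add_induct)
  case (1 k d)
  show ?case by (simp add: act_mult_single act_single)
next
  case (2 f f')
  thus ?case by (simp add: distrib_right act_add)
qed

private lemma act_free_gen: "act (free_gen g) v = gen_act g v"
  by (rule ext) (simp add: free_gen_def act_single)

private lemma act_one: "act 1 v = v"
  by (rule ext) (simp add: act_single zero_word_def flip: single_one)

private lemma act_relator:
  assumes "f \<in> weyl_relators" shows "act f v m = 0"
proof -
  have comm: "gen_act (Gen_x i) (gen_act (Gen_x j) v) m = gen_act (Gen_x j) (gen_act (Gen_x i) v) m"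
    "gen_act (Gen_d i) (gen_act (Gen_d j) v) m = gen_act (Gen_d j) (gen_act (Gen_d i) v) m" for i j
    by (cases "i = j"; simp add: fun_upd_twist)+
  have weyl: "gen_act (Gen_d i) (gen_act (Gen_x j) v) m =
    gen_act (Gen_x j) (gen_act (Gen_d i) v) m + (if i = j then v m else 0)" for i j
    by (cases "i = j"; cases "m i"; cases "m j") (simp_all add: fun_upd_twist algebra_simps fun_upd_idem)
  have act_mult': "act (f * g) v = act f (act g v)" for f g :: "'a weyl_gen free_alg"
    by (rule ext) (rule act_mult)
  from assms show ?thesis
    unfolding weyl_relators_def
    apply (elim UnE CollectE exE conjE)
    subgoal for i j by (simp only: act_diff act_mult' act_free_gen comm(1)[of i j] diff_self)
    subgoal for i j by (simp only: act_diff act_mult' act_free_gen comm(2)[of i j] diff_self)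
    subgoal for i j
      by (cases "i = j")
        (simp_all add: act_diff act_mult' act_free_gen weyl act_one act_zero del: gen_act.simps)
    done
qed

lemma one_not_in_weyl_ideal: "1 \<notin> weyl_ideal"
proof
  assume one: "1 \<in> (weyl_ideal :: 'n weyl_gen free_alg set)"
  let ?R = "ring_of_type_algebra :: 'n weyl_gen free_alg ring"
  interpret R: ring ?R by (rule ring_ring_of_type_algebra)
  define K :: "'n weyl_gen free_alg set" where "K = {f. \<forall>v m. act f v m = 0}"
  have "ideal K ?R"
  proof (rule idealI)
    show "subgroup K (add_monoid ?R)"
    proof (rule R.add.subgroupI)
      have "0 \<in> K" by (simp add: K_def act_zero)
      thus "K \<noteq> {}" by blast
    next
      fix a assume "a \<in> K"
      thus "\<ominus>\<^bsub>?R\<^esub> a \<in> K"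
        using act_diff[of 0 a] by (simp add: K_def act_zero)
    qed (auto simp: K_def act_add)
    fix a x assume "a \<in> K"
    have zero: "act x (\<lambda>_. 0) m = 0" for m and x :: "'n weyl_gen free_alg"
      using act_linear(2)[of x 0 "\<lambda>_. 0"] by simp
    have "act a v = (\<lambda>_. 0)" for v using \<open>a \<in> K\<close> by (auto simp: K_def)
    thus "x \<otimes>\<^bsub>?R\<^esub> a \<in> K" "a \<otimes>\<^bsub>?R\<^esub> x \<in> K"
      by (simp_all add: K_def act_mult zero)
  qed (rule ring_ring_of_type_algebra)
  hence "weyl_ideal \<subseteq> K"
    unfolding weyl_ideal_def by (rule R.genideal_minimal) (auto simp: K_def act_relator)
  with one have "act (1 :: 'n weyl_gen free_alg) (\<lambda>_. 1) (\<lambda>_. 0) = 0"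
    by (auto simp: K_def)
  thus False by (simp add: act_one)
qed

end

instantiation weyl :: (type) ring_1
begin

lift_definition zero_weyl :: "'a weyl" is 0 .

lift_definition one_weyl :: "'a weyl" is 1 .

lift_definition plus_weyl :: "'a weyl \<Rightarrow> 'a weyl \<Rightarrow> 'a weyl" is "(+)"
  unfolding weyl_eq_def using weyl_ideal_add by (metis add_diff_add)

lift_definition uminus_weyl :: "'a weyl \<Rightarrow> 'a weyl" is uminus
  unfolding weyl_eq_def by (drule weyl_ideal_uminus) simp

lift_definition minus_weyl :: "'a weyl \<Rightarrow> 'a weyl \<Rightarrow> 'a weyl" is "(-)"
  unfolding weyl_eq_def
proof -
  fix f g f' g' :: "'a weyl_gen free_alg"
  assume "f - f' \<in> weyl_ideal" "g - g' \<in> weyl_ideal"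
  from weyl_ideal_add[OF this(1) weyl_ideal_uminus[OF this(2)]]
  show "f - g - (f' - g') \<in> weyl_ideal" by (simp add: algebra_simps)
qed

lift_definition times_weyl :: "'a weyl \<Rightarrow> 'a weyl \<Rightarrow> 'a weyl" is "(*)"
  unfolding weyl_eq_def
proof -
  fix f g f' g' :: "'a weyl_gen free_alg"
  assume "f - f' \<in> weyl_ideal" "g - g' \<in> weyl_ideal"
  hence "(f - f') * g + f' * (g - g') \<in> weyl_ideal"
    by (intro weyl_ideal_add weyl_ideal_mult_left weyl_ideal_mult_right)
  thus "f * g - f' * g' \<in> weyl_ideal" by (simp add: algebra_simps)
qed

instance
proof
  fix a b c :: "'a weyl"
  have refl: "weyl_eq f f" for f :: "'a weyl_gen free_alg"
    by (simp add: weyl_eq_def weyl_ideal_zero)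
  note [simp] = refl
  show "a + b + c = a + (b + c)" by transfer (simp add: add.assoc)
  show "a + b = b + a" by transfer (simp add: add.commute)
  show "0 + a = a" by transfer simp
  show "- a + a = 0" by transfer simp
  show "a - b = a + - b" by transfer simp
  show "a * b * c = a * (b * c)" by transfer (simp add: mult.assoc)
  show "(a + b) * c = a * c + b * c" by transfer (simp add: distrib_right)
  show "a * (b + c) = a * b + a * c" by transfer (simp add: distrib_left)
  show "1 * a = a" by transfer simp
  show "a * 1 = a" by transfer simp
  show "(0::'a weyl) \<noteq> 1"
  proof transfer
    show "\<not> weyl_eq (0 :: 'a weyl_gen free_alg) 1"
      using one_not_in_weyl_ideal weyl_ideal_uminus[of "-1"] by (auto simp: weyl_eq_def)
  qed
qed

end


lift_definition weyl_x :: "'n \<Rightarrow> 'n weyl" is "\<lambda>i. free_gen (Gen_x i)" .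

lift_definition weyl_d :: "'n \<Rightarrow> 'n weyl" is "\<lambda>i. free_gen (Gen_d i)" .

lift_definition weyl_const :: "complex \<Rightarrow> 'n weyl" is "Poly_Mapping.single 0" .

lemma weyl_relations:
  "weyl_x i * weyl_x j = weyl_x j * weyl_x i"
  "weyl_d i * weyl_d j = weyl_d j * weyl_d i"
  "weyl_d i * weyl_x j - weyl_x j * weyl_d i = (if i = j then 1 else 0)"
proof -
  show "weyl_x i * weyl_x j = weyl_x j * weyl_x i"
  proof transfer
    fix i j :: 'a
    have "free_gen (Gen_x i) * free_gen (Gen_x j) - free_gen (Gen_x j) * free_gen (Gen_x i) \<in> weyl_relators"
      unfolding weyl_relators_def by blast
    thus "weyl_eq (free_gen (Gen_x i) * free_gen (Gen_x j)) (free_gen (Gen_x j) * free_gen (Gen_x i))"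
      using weyl_relators_subset by (auto simp: weyl_eq_def)
  qed
  show "weyl_d i * weyl_d j = weyl_d j * weyl_d i"
  proof transfer
    fix i j :: 'a
    have "free_gen (Gen_d i) * free_gen (Gen_d j) - free_gen (Gen_d j) * free_gen (Gen_d i) \<in> weyl_relators"
      unfolding weyl_relators_def by blast
    thus "weyl_eq (free_gen (Gen_d i) * free_gen (Gen_d j)) (free_gen (Gen_d j) * free_gen (Gen_d i))"
      using weyl_relators_subset by (auto simp: weyl_eq_def)
  qed
  have "weyl_d i * weyl_x j - weyl_x j * weyl_d i - (if i = j then 1 else 0) = 0"
  proof transfer
    fix i j :: 'a
    have "free_gen (Gen_d i) * free_gen (Gen_x j) - free_gen (Gen_x j) * free_gen (Gen_d i)
        - (if i = j then 1 else 0) \<in> weyl_relators"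
      unfolding weyl_relators_def by blast
    thus "weyl_eq (free_gen (Gen_d i) * free_gen (Gen_x j) - free_gen (Gen_x j) * free_gen (Gen_d i)
        - (if i = j then 1 else 0)) 0"
      using weyl_relators_subset by (auto simp: weyl_eq_def)
  qed
  thus "weyl_d i * weyl_x j - weyl_x j * weyl_d i = (if i = j then 1 else 0)" by simp
qed

lemma weyl_const_simps [simp]:
  "weyl_const 0 = 0" "weyl_const 1 = 1"
  "weyl_const (a + b) = weyl_const a + weyl_const b"
  "weyl_const (a * b) = weyl_const a * weyl_const b"
  by (transfer, simp add: weyl_eq_def weyl_ideal_zero single_add Poly_Mapping.mult_single)+

lemma free_alg_const_central:
  "Poly_Mapping.single 0 c * f = f * Poly_Mapping.single 0 (c :: complex)"
  by (induction f rule: poly_mapping_add_induct)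
     (simp_all add: Poly_Mapping.mult_single mult.commute distrib_left distrib_right)

lemma weyl_const_central: "weyl_const c * u = u * weyl_const c"
  by transfer (simp add: free_alg_const_central weyl_eq_def weyl_ideal_zero)


section \<open>The rings \<open>A = \<complex>[s]\<close> and \<open>R = D\<^sub>n[s]\<close>\<close>

text \<open>
  With monomials \<^typ>\<open>'p \<Rightarrow>\<^sub>0 nat\<close> as keys, convolution is the product of polynomials in central variables
  indexed by \<open>'p\<close>, over a possibly noncommutative coefficient ring.
\<close>

type_synonym 'p cpoly = "('p \<Rightarrow>\<^sub>0 nat) \<Rightarrow>\<^sub>0 complex"

type_synonym ('n, 'p) weyl_poly = "('p \<Rightarrow>\<^sub>0 nat) \<Rightarrow>\<^sub>0 'n weyl"

abbreviation cpoly_ring :: "'p cpoly ring" where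
  "cpoly_ring \<equiv> ring_of_type_algebra"

abbreviation weyl_poly_ring :: "('n, 'p) weyl_poly ring" where
  "weyl_poly_ring \<equiv> ring_of_type_algebra"

definition cpoly_embed :: "'p cpoly \<Rightarrow> ('n, 'p) weyl_poly" where
  "cpoly_embed = Poly_Mapping.map weyl_const"

lemma cpoly_embed_single:
  "cpoly_embed (Poly_Mapping.single m c) = Poly_Mapping.single m (weyl_const c)"
  by (rule poly_mapping_eqI) (simp add: cpoly_embed_def Poly_Mapping.map.rep_eq lookup_single when_def)

lemma cpoly_embed_add: "cpoly_embed (f + g) = cpoly_embed f + cpoly_embed g"
  by (rule poly_mapping_eqI) (auto simp: cpoly_embed_def Poly_Mapping.map.rep_eq lookup_add when_def
      simp flip: weyl_const_simps(3))

lemma cpoly_embed_one: "cpoly_embed 1 = 1"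
  using cpoly_embed_single[of 0 1] by simp

lemma cpoly_embed_mult: "cpoly_embed (f * g) = cpoly_embed f * cpoly_embed g"
proof (induction f rule: poly_mapping_add_induct)
  case (1 k c)
  show ?case
    by (induction g rule: poly_mapping_add_induct)
       (simp_all add: Poly_Mapping.mult_single cpoly_embed_single cpoly_embed_add distrib_left)
qed (simp add: distrib_right cpoly_embed_add)

lemma cpoly_embed_central: "cpoly_embed f * u = u * cpoly_embed f"
proof (induction f rule: poly_mapping_add_induct)
  case (1 k c)
  show ?case
    by (induction u rule: poly_mapping_add_induct)
       (simp_all add: Poly_Mapping.mult_single cpoly_embed_single weyl_const_central add.commute
         distrib_left distrib_right)
qed (simp add: cpoly_embed_add distrib_left distrib_right)

definition cpoly_eval :: "('p::finite \<Rightarrow> complex) \<Rightarrow> 'p cpoly \<Rightarrow> complex" where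
  "cpoly_eval \<alpha> f = (\<Sum>m\<in>Poly_Mapping.keys f.
     Poly_Mapping.lookup f m * (\<Prod>i\<in>UNIV. \<alpha> i ^ Poly_Mapping.lookup m i))"

definition zero_locus :: "'p::finite cpoly set \<Rightarrow> ('p \<Rightarrow> complex) set" where
  "zero_locus F = {\<alpha>. \<forall>f\<in>F. cpoly_eval \<alpha> f = 0}"

definition point_ideal :: "('p::finite \<Rightarrow> complex) \<Rightarrow> 'p cpoly set" where
  "point_ideal \<alpha> = {f. cpoly_eval \<alpha> f = 0}"


section \<open>Left ideals and minimal primes\<close>

text \<open>The locale \<^locale>\<open>ideal\<close> of HOL-Algebra is for two-sided ideals.\<close>

locale left_ideal = additive_subgroup I R + ring R for I and R (structure) +
  assumes I_l_closed: "\<lbrakk>a \<in> I; x \<in> carrier R\<rbrakk> \<Longrightarrow> x \<otimes> a \<in> I"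

definition minimal_prime :: "'a set \<Rightarrow> 'a set \<Rightarrow> ('a, 'm) ring_scheme \<Rightarrow> bool" where
  "minimal_prime P I A \<longleftrightarrow> primeideal P A \<and> I \<subseteq> P \<and>
     (\<forall>Q. primeideal Q A \<and> I \<subseteq> Q \<and> Q \<subseteq> P \<longrightarrow> Q = P)"

definition cpoly_contraction :: "('n, 'p) weyl_poly set \<Rightarrow> 'p cpoly set" where
  "cpoly_contraction J = {f. cpoly_embed f \<in> J}"


section \<open>Quotient modules and tensor products\<close>

text \<open>
  The fields \<^const>\<open>monoid.mult\<close> and \<^const>\<open>one\<close> of a \<open>module\<close> record play no role in the theory of
  modules, so quotients leave them undefined.
\<close>

definition restrict_scalars :: "('a \<Rightarrow> 'b) \<Rightarrow> 'b ring \<Rightarrow> ('a, 'b) module" where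
  "restrict_scalars \<phi> S =
     \<lparr>carrier = carrier S, monoid.mult = monoid.mult S, one = one S, ring.zero = ring.zero S, add = add S,
      module.smult = (\<lambda>a x. \<phi> a \<otimes>\<^bsub>S\<^esub> x)\<rparr>"

definition quotient_module :: "('a, 'b, 'm) module_scheme \<Rightarrow> 'b set \<Rightarrow> ('a, 'b set) module" where
  "quotient_module M N =
     \<lparr>carrier = a_rcosets\<^bsub>M\<^esub> N, monoid.mult = undefined, one = undefined, ring.zero = N,
      add = set_add M, module.smult = (\<lambda>a C. \<Union>x\<in>C. N +>\<^bsub>M\<^esub> (a \<odot>\<^bsub>M\<^esub> x))\<rparr>"

definition tensor_relators ::
  "('a, 'k) ring_scheme \<Rightarrow> ('a, 'b, 'm) module_scheme \<Rightarrow> ('a, 'c, 'n) module_scheme \<Rightarrow>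
     ('b \<times> 'c \<Rightarrow>\<^sub>0 int) set" where
  "tensor_relators A M N =
     {frag_of (x \<oplus>\<^bsub>M\<^esub> x', y) - frag_of (x, y) - frag_of (x', y) |x x' y.
        x \<in> carrier M \<and> x' \<in> carrier M \<and> y \<in> carrier N} \<union>
     {frag_of (x, y \<oplus>\<^bsub>N\<^esub> y') - frag_of (x, y) - frag_of (x, y') |x y y'.
        x \<in> carrier M \<and> y \<in> carrier N \<and> y' \<in> carrier N} \<union>
     {frag_of (a \<odot>\<^bsub>M\<^esub> x, y) - frag_of (x, a \<odot>\<^bsub>N\<^esub> y) |a x y.
        a \<in> carrier A \<and> x \<in> carrier M \<and> y \<in> carrier N}"

text \<open>
  The underlying abelian group of \<open>M \<otimes>\<^sub>A N\<close> for a commutative ring \<open>A\<close>, written multiplicatively as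
  in the library's \<^const>\<open>free_Abelian_group\<close>: the zero of \<open>M \<otimes>\<^sub>A N\<close> is \<open>\<one>\<close>.
\<close>

definition tensor_product ::
  "('a, 'k) ring_scheme \<Rightarrow> ('a, 'b, 'm) module_scheme \<Rightarrow> ('a, 'c, 'n) module_scheme \<Rightarrow>
     ('b \<times> 'c \<Rightarrow>\<^sub>0 int) set monoid" where
  "tensor_product A M N =
     (let F = free_Abelian_group (carrier M \<times> carrier N)
      in F Mod (generate F (tensor_relators A M N)))"

lemma comm_group_extend:
  assumes "comm_group \<lparr>carrier = C, monoid.mult = m, one = e\<rparr>"
  shows "comm_group \<lparr>carrier = C, monoid.mult = m, one = e, \<dots> = z\<rparr>"
  using assms
  unfolding comm_group_def group_def group_axioms_def comm_monoid_def comm_monoid_axioms_def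
    monoid_def Units_def
  unfolding partial_object.simps monoid.simps by assumption

lemma module_restrict_scalars:
  assumes "cring A" "ring S" "\<phi> \<in> ring_hom A S"
  shows "module A (restrict_scalars \<phi> S)"
proof -
  interpret A: cring A by fact
  interpret S: ring S by fact
  interpret h: ring_hom_ring A S \<phi> by (rule ring_hom_ringI2) (fact A.ring_axioms assms)+
  have "abelian_group (restrict_scalars \<phi> S)"
    using comm_group_extend[OF S.a_comm_group[simplified]]
    by (intro comm_group_abelian_groupI) (simp add: restrict_scalars_def)
  thus ?thesis
    using assms(1) by (intro moduleI) (simp_all add: restrict_scalars_def S.l_distr S.r_distr S.m_assoc)
qed

lemma (in module) quotient_module_smult:
  assumes "submodule N R M" "a \<in> carrier R" "x \<in> carrier M"
  shows "a \<odot>\<^bsub>quotient_module M N\<^esub> (N +>\<^bsub>M\<^esub> x) = N +>\<^bsub>M\<^esub> (a \<odot>\<^bsub>M\<^esub> x)"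
proof -
  interpret N: submodule N R M by fact
  have sub: "N \<subseteq> carrier M" using N.subset by simp
  have grp: "additive_subgroup N M" by (rule additive_subgroup.intro) (rule N.subgroup_axioms)
  have eq: "N +>\<^bsub>M\<^esub> (a \<odot>\<^bsub>M\<^esub> y) = N +>\<^bsub>M\<^esub> (a \<odot>\<^bsub>M\<^esub> x)" if "y \<in> N +>\<^bsub>M\<^esub> x" for y
  proof -
    from that obtain z where z: "z \<in> N" "y = z \<oplus>\<^bsub>M\<^esub> x"
      by (auto simp: a_r_coset_def r_coset_def)
    have "a \<odot>\<^bsub>M\<^esub> y \<in> N +>\<^bsub>M\<^esub> (a \<odot>\<^bsub>M\<^esub> x)"
      using z sub assms(2,3) N.smult_closed[OF assms(2) z(1)]
      by (auto simp: a_r_coset_def r_coset_def subsetD intro!: bexI[of _ "a \<odot>\<^bsub>M\<^esub> z"] smult_r_distr)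
    thus ?thesis
      using M.a_repr_independence[OF _ _ N.subgroup_axioms] assms(2,3) smult_closed by metis
  qed
  have "(\<Union>y\<in>N +>\<^bsub>M\<^esub> x. N +>\<^bsub>M\<^esub> (a \<odot>\<^bsub>M\<^esub> y)) = (\<Union>y\<in>N +>\<^bsub>M\<^esub> x. N +>\<^bsub>M\<^esub> (a \<odot>\<^bsub>M\<^esub> x))"
    by (rule SUP_cong[OF refl eq])
  moreover have "x \<in> N +>\<^bsub>M\<^esub> x"
    using sub N.one_closed assms(3) by (force simp: a_r_coset_def r_coset_def)
  hence "N +>\<^bsub>M\<^esub> x \<noteq> {}" by blast
  ultimately show ?thesis
    by (simp only: quotient_module_def module.simps SUP_constant if_False)
qed

lemma (in module) module_quotient_module:
  assumes "submodule N R M"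
  shows "module R (quotient_module M N)"
proof -
  interpret N: submodule N R M by fact
  interpret N: abelian_subgroup N M
    by (rule abelian_subgroupI3)
       (auto intro: additive_subgroup.intro N.subgroup_axioms M.abelian_group_axioms)
  let ?Q = "quotient_module M N"
  have simps: "carrier ?Q = a_rcosets\<^bsub>M\<^esub> N" "add ?Q = set_add M" "ring.zero ?Q = N"
    by (simp_all add: quotient_module_def)
  have "comm_group (add_monoid ?Q)"
    using comm_group_extend[OF N.a_factorgroup_is_comm_group[unfolded A_FactGroup_def']]
    by (simp add: simps)
  hence ab: "abelian_group ?Q" by (rule comm_group_abelian_groupI)
  have elim: "\<exists>x\<in>carrier M. C = N +>\<^bsub>M\<^esub> x" if "C \<in> carrier ?Q" for C
    using that by (auto simp: simps A_RCOSETS_def' a_r_coset_def')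
  have coset: "N +>\<^bsub>M\<^esub> x \<in> carrier ?Q" if "x \<in> carrier M" for x
    using that by (auto simp: simps A_RCOSETS_def' a_r_coset_def')
  have add: "(N +>\<^bsub>M\<^esub> x) \<oplus>\<^bsub>?Q\<^esub> (N +>\<^bsub>M\<^esub> y) = N +>\<^bsub>M\<^esub> (x \<oplus>\<^bsub>M\<^esub> y)"
    if "x \<in> carrier M" "y \<in> carrier M" for x y
    using that by (simp add: simps N.a_rcos_sum)
  note smult = quotient_module_smult[OF assms]
  show ?thesis
  proof (rule moduleI)
    show "cring R" by (rule R.is_cring)
    show "abelian_group ?Q" by (rule ab)
  next
    fix a x assume "a \<in> carrier R" "x \<in> carrier ?Q"
    thus "a \<odot>\<^bsub>?Q\<^esub> x \<in> carrier ?Q"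
      using elim[of x] smult coset by force
  next
    fix a b x assume *: "a \<in> carrier R" "b \<in> carrier R" "x \<in> carrier ?Q"
    then obtain y where y: "y \<in> carrier M" "x = N +>\<^bsub>M\<^esub> y" using elim by blast
    show "(a \<oplus>\<^bsub>R\<^esub> b) \<odot>\<^bsub>?Q\<^esub> x = a \<odot>\<^bsub>?Q\<^esub> x \<oplus>\<^bsub>?Q\<^esub> b \<odot>\<^bsub>?Q\<^esub> x"
      using * y by (simp add: smult add smult_l_distr)
    show "(a \<otimes>\<^bsub>R\<^esub> b) \<odot>\<^bsub>?Q\<^esub> x = a \<odot>\<^bsub>?Q\<^esub> (b \<odot>\<^bsub>?Q\<^esub> x)"
      using * y by (simp add: smult smult_assoc1)
  next
    fix a x y assume *: "a \<in> carrier R" "x \<in> carrier ?Q" "y \<in> carrier ?Q"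
    then obtain u v where uv: "u \<in> carrier M" "x = N +>\<^bsub>M\<^esub> u" "v \<in> carrier M" "y = N +>\<^bsub>M\<^esub> v"
      using elim by blast
    show "a \<odot>\<^bsub>?Q\<^esub> (x \<oplus>\<^bsub>?Q\<^esub> y) = a \<odot>\<^bsub>?Q\<^esub> x \<oplus>\<^bsub>?Q\<^esub> a \<odot>\<^bsub>?Q\<^esub> y"
      using * uv by (simp add: smult add smult_r_distr)
  next
    fix x assume "x \<in> carrier ?Q"
    thus "\<one>\<^bsub>R\<^esub> \<odot>\<^bsub>?Q\<^esub> x = x"
      using elim[of x] smult by auto
  qed
qed

lemma keys_diff_subset:
  fixes f g :: "'a \<Rightarrow>\<^sub>0 'b::cancel_comm_monoid_add"
  assumes "Poly_Mapping.keys f \<subseteq> S" "Poly_Mapping.keys g \<subseteq> S"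
  shows "Poly_Mapping.keys (f - g) \<subseteq> S"
  using keys_diff[of f g] assms by blast

lemma comm_group_tensor_product:
  assumes "module A M" "module A N"
  shows "comm_group (tensor_product A M N)"
proof -
  interpret M: module A M by fact
  interpret N: module A N by fact
  let ?F = "free_Abelian_group (carrier M \<times> carrier N)"
  interpret F: comm_group ?F by (rule abelian_free_Abelian_group)
  have "tensor_relators A M N \<subseteq> carrier ?F"
  proof
    fix c assume "c \<in> tensor_relators A M N"
    hence "Poly_Mapping.keys c \<subseteq> carrier M \<times> carrier N"
      unfolding tensor_relators_def by (elim UnE CollectE exE conjE) (simp_all add: keys_diff_subset)
    thus "c \<in> carrier ?F" by (simp add: free_Abelian_group_def)
  qed
  hence "subgroup (generate ?F (tensor_relators A M N)) ?F"
    by (rule F.generate_is_subgroup)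
  thus ?thesis
    unfolding tensor_product_def Let_def by (rule F.abelian_FactGroup)
qed

definition weyl_poly_quotient :: "('n, 'p) weyl_poly set \<Rightarrow> ('p cpoly, ('n, 'p) weyl_poly set) module" where
  "weyl_poly_quotient J = quotient_module (restrict_scalars cpoly_embed weyl_poly_ring) J"

definition cpoly_quotient :: "'p cpoly set \<Rightarrow> ('p cpoly, 'p cpoly set) module" where
  "cpoly_quotient I = quotient_module (restrict_scalars id cpoly_ring) I"

lemma module_weyl_poly_quotient:
  assumes "left_ideal J (weyl_poly_ring :: ('n, 'p) weyl_poly ring)"
  shows "module cpoly_ring (weyl_poly_quotient J)"
proof -
  interpret left_ideal J "weyl_poly_ring :: ('n, 'p) weyl_poly ring" by fact
  let ?M = "restrict_scalars cpoly_embed weyl_poly_ring :: ('p cpoly, ('n, 'p) weyl_poly) module"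
  have "cpoly_embed \<in> ring_hom cpoly_ring (weyl_poly_ring :: ('n, 'p) weyl_poly ring)"
    by (rule ring_hom_memI) (simp_all add: cpoly_embed_mult cpoly_embed_add cpoly_embed_one)
  hence "module cpoly_ring ?M"
    by (intro module_restrict_scalars cring_from_type_algebra ring_ring_of_type_algebra)
  moreover have "submodule J cpoly_ring ?M"
  proof (rule submodule.intro)
    show "subgroup J (add_monoid ?M)"
      using a_subgroup by (simp add: restrict_scalars_def subgroup_def m_inv_def)
    show "submodule_axioms J cpoly_ring ?M"
      using I_l_closed by unfold_locales (simp add: restrict_scalars_def)
  qed
  ultimately show ?thesis
    unfolding weyl_poly_quotient_def by (rule module.module_quotient_module)
qed

lemma module_cpoly_quotient:
  assumes "ideal I cpoly_ring"
  shows "module cpoly_ring (cpoly_quotient I)"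
proof -
  interpret ideal I cpoly_ring by fact
  let ?M = "restrict_scalars id cpoly_ring"
  have "module cpoly_ring ?M"
    by (intro module_restrict_scalars cring_from_type_algebra ring_ring_of_type_algebra id_ring_hom)
  moreover have "submodule I cpoly_ring ?M"
  proof (rule submodule.intro)
    show "subgroup I (add_monoid ?M)"
      using a_subgroup by (simp add: restrict_scalars_def subgroup_def m_inv_def)
    show "submodule_axioms I cpoly_ring ?M"
      using I_l_closed by unfold_locales (simp add: restrict_scalars_def)
  qed
  ultimately show ?thesis
    unfolding cpoly_quotient_def by (rule module.module_quotient_module)
qed

end

theory Submission
  imports Defs
begin

text \<open>
  Choose a left ideal \<open>L \<supseteq> J\<close> of \<open>R\<close> maximal among those with \<open>L \<inter> A \<subseteq> P\<close>. Then \<open>L \<inter> A\<close> is prime, so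
  \<open>L \<inter> A = P\<close> by minimality of \<open>P\<close>, and it suffices to find \<open>h\<close> with \<open>1 \<notin> L + m R\<close> for all maximal
  ideals \<open>m \<supseteq> P\<close> not containing \<open>h\<close>. This is an effective form of generic freeness: order the monomials
  in the \<open>x\<^sub>i, \<partial>\<^sub>i\<close>. By Dickson's lemma finitely many elements of \<open>L\<close> with leading coefficients outside \<open>P\<close>
  have leading exponents dividing all other such exponents; let \<open>h\<close> be the product of their leading
  coefficients. An element of \<open>L\<close> congruent modulo \<open>m R\<close> to a constant outside \<open>m\<close> can then be
  reduced, without losing this property, until it is a constant in \<open>L \<inter> A = P \<subseteq> m\<close>, a contradiction.
  Only spanning by the monomials is used, not their linear independence over \<open>A\<close>.
\<close>

section \<open>Ideals as closure conditions on sets\<close>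

lemma left_ideal_type_iff:
  "left_ideal I (ring_of_type_algebra :: 'r::ring_1 ring) \<longleftrightarrow>
     0 \<in> I \<and> (\<forall>a\<in>I. \<forall>b\<in>I. a + b \<in> I) \<and> (\<forall>a\<in>I. \<forall>r. r * a \<in> I)"
  (is "?L \<longleftrightarrow> ?R")
proof
  assume ?L
  then interpret left_ideal I "ring_of_type_algebra :: 'r ring" .
  show ?R
    using additive_subgroup.zero_closed[OF additive_subgroup_axioms]
      additive_subgroup.a_closed[OF additive_subgroup_axioms] I_l_closed by auto
next
  assume R: ?R
  interpret R: ring "ring_of_type_algebra :: 'r ring" by (rule ring_ring_of_type_algebra)
  have neg: "- a \<in> I" if "a \<in> I" for a
    using R that by (metis mult_minus1)
  have "subgroup I (add_monoid (ring_of_type_algebra :: 'r ring))"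
  proof (rule R.add.subgroupI)
    show "I \<noteq> {}" using R by blast
    fix a assume "a \<in> I"
    thus "\<ominus>\<^bsub>ring_of_type_algebra\<^esub> a \<in> I" by (simp add: neg)
  qed (use R in auto)
  thus ?L
    using R by unfold_locales (auto simp: subgroup_def)
qed

lemma primeideal_type_iff:
  "primeideal I (ring_of_type_algebra :: 'a::comm_ring_1 ring) \<longleftrightarrow>
     0 \<in> I \<and> (\<forall>a\<in>I. \<forall>b\<in>I. a + b \<in> I) \<and> (\<forall>a\<in>I. \<forall>r. r * a \<in> I) \<and> 1 \<notin> I \<and>
     (\<forall>a b. a * b \<in> I \<longrightarrow> a \<in> I \<or> b \<in> I)"
  (is "?L \<longleftrightarrow> ?R")
proof
  assume ?L
  then interpret primeideal I "ring_of_type_algebra :: 'a ring" .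
  have "1 \<notin> I"
  proof
    assume "1 \<in> I"
    hence "I = UNIV" using I_l_closed[of 1] by auto
    thus False using I_notcarr by simp
  qed
  thus ?R
    using additive_subgroup.zero_closed[OF additive_subgroup_axioms]
      additive_subgroup.a_closed[OF additive_subgroup_axioms] I_l_closed I_prime by auto
next
  assume R: ?R
  interpret R: cring "ring_of_type_algebra :: 'a ring" by (rule cring_from_type_algebra)
  have "left_ideal I (ring_of_type_algebra :: 'a ring)"
    using R by (simp add: left_ideal_type_iff)
  then interpret left_ideal I "ring_of_type_algebra :: 'a ring" .
  have "ideal I (ring_of_type_algebra :: 'a ring)"
    using R a_subgroup by (intro idealI R.ring_axioms) (auto simp: mult.commute)
  thus ?L
    using R by (intro primeidealI R.is_cring) auto
qed


section \<open>Dickson's lemma\<close>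

text \<open>Some subsequence is monotone. If it decreases, it attains a minimum at some index and is
  constant from there on, so dropping the earlier terms makes it increasing.\<close>

lemma nat_seq_incseq_subseq:
  fixes s :: "nat \<Rightarrow> nat"
  shows "\<exists>r. strict_mono r \<and> incseq (s o r)"
proof -
  obtain r where r: "strict_mono r" "monoseq (s o r)"
    using seq_monosub[of s] by (auto simp: o_def)
  show ?thesis
  proof (cases "incseq (s o r)")
    case False
    hence dec: "decseq (s o r)" using r(2) by (auto simp: monoseq_iff)
    obtain k where k: "\<And>n. (s o r) k \<le> (s o r) n"
      using ex_has_least_nat[of "\<lambda>_. True" 0 "s o r"] by auto
    have "(s o r) (n + k) = (s o r) k" for n
      using k[of "n + k"] decseqD[OF dec, of k "n + k"] by simp
    hence "incseq (s o (r o (\<lambda>n. n + k)))"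
      by (simp add: incseq_def)
    moreover have "strict_mono (r o (\<lambda>n. n + k))"
      using r(1) by (simp add: strict_mono_def)
    ultimately show ?thesis by blast
  qed (use r in blast)
qed

text \<open>The subsequence is refined for one coordinate at a time; a further subsequence stays
  increasing in the coordinates already treated.\<close>

lemma fun_nat_seq_incseq_subseq:
  fixes s :: "nat \<Rightarrow> 'v \<Rightarrow> nat"
  assumes "finite S"
  shows "\<exists>r. strict_mono r \<and> (\<forall>v\<in>S. incseq (\<lambda>n. s (r n) v))"
  using assms
proof induction
  case empty
  show ?case by (auto intro: exI[of _ id] simp: strict_mono_def)
next
  case (insert v S)
  then obtain r where r: "strict_mono r" "\<forall>v\<in>S. incseq (\<lambda>n. s (r n) v)" by blast
  obtain q where q: "strict_mono q" "incseq ((\<lambda>n. s (r n) v) o q)"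
    using nat_seq_incseq_subseq by blast
  have "strict_mono (r o q)" using r(1) q(1) by (simp add: strict_mono_def)
  moreover have "incseq (\<lambda>n. s ((r o q) n) w)" if "w \<in> insert v S" for w
    using that r(2) q strict_mono_mono[OF q(1)] by (auto simp: monotone_on_def)
  ultimately show ?case by blast
qed

text \<open>\<open>G\<close> consists of the minimal elements of \<open>E\<close>. Were it infinite,
  an injective sequence in it would have a coordinatewise increasing subsequence, whose first two
  members would be comparable, hence equal.\<close>

lemma dickson:
  fixes E :: "('v::finite \<Rightarrow> nat) set"
  obtains G where "G \<subseteq> E" "finite G" "\<And>e. e \<in> E \<Longrightarrow> \<exists>g\<in>G. g \<le> e"
proof -
  define G where "G = {e\<in>E. \<forall>g\<in>E. g \<le> e \<longrightarrow> g = e}"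
  have "finite G"
  proof (rule ccontr)
    assume "infinite G"
    then obtain s :: "nat \<Rightarrow> 'v \<Rightarrow> nat" where s: "inj s" "range s \<subseteq> G"
      using infinite_countable_subset by blast
    obtain r where r: "strict_mono r" "\<forall>v\<in>UNIV. incseq (\<lambda>n. s (r n) v)"
      using fun_nat_seq_incseq_subseq[of UNIV s] by auto
    have "s (r 0) \<le> s (r 1)" using r(2) by (auto simp: le_fun_def incseq_def)
    moreover have "s (r 0) \<in> G" "s (r 1) \<in> G" using s(2) by auto
    ultimately have "s (r 0) = s (r 1)" by (simp add: G_def)
    hence "r 0 = r 1" using s(1) by (simp add: inj_eq)
    thus False using strict_monoD[OF r(1), of 0 1] by simp
  qed
  \<comment> \<open>A non-minimal element dominates another element of \<open>E\<close> with smaller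
    coordinate sum, so the descent ends in \<open>G\<close>.\<close>
  moreover have "\<exists>g\<in>G. g \<le> e" if "e \<in> E" for e
    using that
  proof (induction "sum e UNIV" arbitrary: e rule: less_induct)
    case less
    show ?case
    proof (cases "e \<in> G")
      case False
      then obtain g where g: "g \<in> E" "g \<le> e" "g \<noteq> e" using less.prems by (auto simp: G_def)
      then obtain v where "g v < e v" by (metis le_funD le_neq_implies_less ext)
      hence "sum g UNIV < sum e UNIV"
        using g(2) by (intro sum_strict_mono_ex1) (auto simp: le_fun_def)
      then obtain g' where "g' \<in> G" "g' \<le> g" using less.hyps g(1) by blast
      thus ?thesis using g(2) order_trans by blast
    qed auto
  qed
  ultimately show thesis using that[of G] by (auto simp: G_def)
qed


section \<open>Rings generated over a central subring by elements with central commutators\<close>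

text \<open>Abstracts from D_n[s]: \<open>em\<close> embeds the central polynomial ring,
  \<open>t\<close> lists the x_i and the derivations, \<open>vs\<close> fixes the order of factors
  in normal monomials, and \<open>p\<close> supplies a prime per generator for the monomial
  order.\<close>

locale central_commutators =
  fixes em :: "'a::comm_ring_1 \<Rightarrow> 'r::ring_1"
    and t :: "'v::finite \<Rightarrow> 'r"
    and c :: "'v \<Rightarrow> 'v \<Rightarrow> 'a"
    and vs :: "'v list"
    and p :: "'v \<Rightarrow> nat"
  assumes em_add: "em (a + b) = em a + em b"
    and em_mult: "em (a * b) = em a * em b"
    and em_one: "em 1 = 1"
    and em_central: "em a * u = u * em a"
    and commutator: "t v * t w = t w * t v + em (c v w)"
    and vs: "distinct vs" "set vs = UNIV"
    and p: "inj p" "Factorial_Ring.prime (p v)"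
begin

section \<open>Normal ordering of monomials\<close>

lemma em_zero: "em 0 = 0"
  using em_add[of 0 0] by simp

lemma em_minus: "em (- a) = - em a"
  using em_add[of a "- a"] by (simp add: em_zero eq_neg_iff_add_eq_0 add.commute)

lemma em_left_commute: "u * (em a * w) = em a * (u * w)"
  by (metis em_central mult.assoc)

text \<open>A Leibniz rule: \<open>t v\<close> passes the \<open>k\<close> factors one by one, each
  leaving the same central commutator. At \<open>k = 0\<close> the truncated \<open>k - 1\<close> is
  harmless because the coefficient is \<open>em 0\<close>.\<close>

lemma commutator_power: "t v * t w ^ k = t w ^ k * t v + em (of_nat k * c v w) * t w ^ (k - 1)"
proof (induction k)
  case (Suc k)
  have "t v * t w ^ Suc k = (t v * t w ^ k) * t w"
    by (simp only: power_Suc2 mult.assoc)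
  also have "\<dots> = t w ^ k * (t v * t w) + em (of_nat k * c v w) * (t w ^ (k - 1) * t w)"
    by (simp only: Suc.IH distrib_right mult.assoc)
  also have "t w ^ k * (t v * t w) = t w ^ Suc k * t v + em (c v w) * t w ^ k"
    by (simp only: commutator[of v w] distrib_left power_Suc2 mult.assoc em_central[of "c v w" "t w ^ k"])
  also have "em (of_nat k * c v w) * (t w ^ (k - 1) * t w) = em (of_nat k * c v w) * t w ^ k"
    by (cases k) (simp_all add: em_zero power_commutes)
  finally show ?case
    by (simp add: em_add distrib_right add.assoc)
qed (simp add: em_zero)

text \<open>The list of factors is a parameter so that reordering can be proved by induction on it;
  normal monomials use the full list \<open>vs\<close>.\<close>

definition lmon :: "'v list \<Rightarrow> ('v \<Rightarrow> nat) \<Rightarrow> 'r" where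
  "lmon us e = prod_list (map (\<lambda>w. t w ^ e w) us)"

abbreviation "nmon \<equiv> lmon vs"

abbreviation inc :: "'v \<Rightarrow> ('v \<Rightarrow> nat) \<Rightarrow> 'v \<Rightarrow> nat" where
  "inc v e \<equiv> e(v := Suc (e v))"

text \<open>With the \<open>p v\<close> distinct primes, \<open>weight\<close> is an injective additive-to-multiplicative encoding of
  exponents, so the order on \<^typ>\<open>nat\<close> induces a monomial order.\<close>

definition weight :: "('v \<Rightarrow> nat) \<Rightarrow> nat" where
  "weight e = (\<Prod>v\<in>UNIV. p v ^ e v)"

lemma lmon_cong: "(\<And>w. w \<in> set us \<Longrightarrow> e w = e' w) \<Longrightarrow> lmon us e = lmon us e'"
  unfolding lmon_def by (metis (mono_tags, lifting) map_cong)

text \<open>\<open>t v\<close> moves right until it meets its own power. Only the factors before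
  \<open>v\<close> are crossed, and each leaves a correction in which its exponent has dropped by
  one.\<close>

lemma lmon_gen_mult:
  assumes "distinct us" "v \<in> set us"
  shows "t v * lmon us e = lmon us (inc v e) +
    (\<Sum>w\<leftarrow>takeWhile (\<lambda>w. w \<noteq> v) us. em (of_nat (e w) * c v w) * lmon us (e(w := e w - 1)))"
  using assms
proof (induction us)
  case (Cons u us)
  have Cons_lmon: "lmon (u # us) e = t u ^ e u * lmon us e" for e by (simp add: lmon_def)
  show ?case
  proof (cases "u = v")
    case True
    hence "lmon us (inc v e) = lmon us e" using Cons.prems by (intro lmon_cong) auto
    hence "lmon (u # us) (inc v e) = t v * (t v ^ e v * lmon us e)"
      using Cons_lmon[of "inc v e"] True by (simp add: mult.assoc)
    moreover have "t v * lmon (u # us) e = t v * (t v ^ e v * lmon us e)"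
      using Cons_lmon[of e] True by simp
    moreover have "takeWhile (\<lambda>w. w \<noteq> v) (u # us) = []" using True by simp
    ultimately show ?thesis by (simp only: list.map sum_list.Nil add_0_right)
  next
    case False
    let ?ws = "takeWhile (\<lambda>w. w \<noteq> v) us"
    have us: "distinct us" "v \<in> set us" using Cons.prems False by auto
    have step: "em a * (t u ^ e u * lmon us (e(w := e w - 1))) = em a * lmon (u # us) (e(w := e w - 1))"
      if "w \<in> set ?ws" for a w
      using set_takeWhileD[OF that] Cons.prems(1) by (auto simp: Cons_lmon)
    have "t v * lmon (u # us) e = (t v * t u ^ e u) * lmon us e"
      by (simp only: Cons_lmon mult.assoc)
    also have "\<dots> = t u ^ e u * (t v * lmon us e) + em (of_nat (e u) * c v u) * (t u ^ (e u - 1) * lmon us e)"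
      by (simp only: commutator_power distrib_right mult.assoc)
    also have "t u ^ (e u - 1) * lmon us e = lmon (u # us) (e(u := e u - 1))"
      using Cons.prems(1) by (auto simp: Cons_lmon intro!: arg_cong2[of _ _ _ _ "(*)"] lmon_cong)
    also have "t u ^ e u * (t v * lmon us e) = t u ^ e u * lmon us (inc v e) +
      (\<Sum>w\<leftarrow>?ws. t u ^ e u * (em (of_nat (e w) * c v w) * lmon us (e(w := e w - 1))))"
      by (simp only: Cons.IH[OF us] distrib_left sum_list_const_mult)
    also have "t u ^ e u * lmon us (inc v e) = lmon (u # us) (inc v e)"
      using False by (simp add: Cons_lmon)
    also have "(\<Sum>w\<leftarrow>?ws. t u ^ e u * (em (of_nat (e w) * c v w) * lmon us (e(w := e w - 1)))) =
      (\<Sum>w\<leftarrow>?ws. em (of_nat (e w) * c v w) * lmon (u # us) (e(w := e w - 1)))"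
      using step by (intro arg_cong[of _ _ sum_list] map_cong refl) (simp only: em_left_commute)
    finally show ?thesis using False by (simp add: add.assoc add.commute del: fun_upd_apply)
  qed
qed simp

lemma nmon_zero: "nmon (\<lambda>_. 0) = 1"
  by (simp add: lmon_def) (induction vs, auto)

section \<open>The monomial order given by weights\<close>

lemma weight_inc: "weight (inc v e) = p v * weight e"
proof -
  have "weight (inc v e) = p v ^ Suc (e v) * (\<Prod>w\<in>UNIV - {v}. p w ^ inc v e w)"
    unfolding weight_def by (subst prod.remove[of _ v]) auto
  also have "(\<Prod>w\<in>UNIV - {v}. p w ^ inc v e w) = (\<Prod>w\<in>UNIV - {v}. p w ^ e w)"
    by (rule prod.cong) auto
  also have "p v ^ Suc (e v) * \<dots> = p v * weight e"
    unfolding weight_def by (subst (2) prod.remove[of _ v]) auto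
  finally show ?thesis .
qed

lemma p_gt_1: "p v > 1"
  using p(2) by (rule prime_gt_1_nat)

lemma weight_pos: "weight e > 0"
  unfolding weight_def using p_gt_1 by (intro prod_pos) (simp add: order_less_trans[of 0 1])

lemma weight_zero: "weight (\<lambda>_. 0) = 1"
  by (simp add: weight_def)

text \<open>Unique factorization: the exponent at \<open>v\<close> is recovered as the multiplicity
  of \<open>p v\<close>, after reindexing the product over the primes themselves.\<close>

lemma weight_inj: "weight e = weight e' \<longleftrightarrow> e = e'"
proof
  assume eq: "weight e = weight e'"
  have "multiplicity (p v) (weight e) = e v" for e v
  proof -
    have "weight e = (\<Prod>q\<in>range p. q ^ e (inv_into UNIV p q))"
      unfolding weight_def using p(1) by (subst prod.reindex) auto
    thus ?thesis
      using p by (subst multiplicity_prod_prime_powers[where f = "\<lambda>q. e (inv_into UNIV p q)"] | auto)+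
  qed
  thus "e = e'" using eq by (metis ext)
qed simp

lemma weight_dec:
  assumes "e w > 0"
  shows "weight (e(w := e w - 1)) < weight e"
proof -
  let ?e = "e(w := e w - 1)"
  have "inc w ?e = e" using assms by auto
  hence "weight e = p w * weight ?e" using weight_inc[where v = w and e = ?e] by simp
  thus ?thesis using weight_pos[of ?e] p_gt_1[of w] by simp
qed

section \<open>The weight filtration\<close>

text \<open>Finite sums of normal monomials with coefficients in \<open>I\<close>. The bound is
  strict, so \<open>Fil I 0\<close> is zero and \<open>Fil UNIV (weight e)\<close> collects the
  terms below \<open>nmon e\<close>. Membership asserts that some expansion exists, which avoids
  speaking of the coefficients of an element.\<close>

inductive_set Fil :: "'a set \<Rightarrow> nat \<Rightarrow> 'r set" for I k where
  Fil_zero: "0 \<in> Fil I k"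
| Fil_step: "u \<in> Fil I k \<Longrightarrow> f \<in> I \<Longrightarrow> weight e < k \<Longrightarrow> u + em f * nmon e \<in> Fil I k"

lemma Fil_add:
  assumes "u \<in> Fil I k" "v \<in> Fil I k"
  shows "u + v \<in> Fil I k"
  using assms(2,1) by induction (auto simp: add.assoc[symmetric] intro: Fil_step)

lemma Fil_mono: "u \<in> Fil I k \<Longrightarrow> I \<subseteq> I' \<Longrightarrow> k \<le> k' \<Longrightarrow> u \<in> Fil I' k'"
  by (induction u rule: Fil.induct) (auto intro: Fil.intros)

lemma Fil_single: "f \<in> I \<Longrightarrow> weight e < k \<Longrightarrow> em f * nmon e \<in> Fil I k"
  using Fil_step[OF Fil_zero] by force

text \<open>The second set \<open>I'\<close> allows coefficients to change ideal: multiplying by an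
  element of an ideal \<open>m\<close> carries \<open>UNIV\<close> into \<open>m\<close>.\<close>

lemma Fil_em_mult:
  assumes "u \<in> Fil I k" "\<And>g. g \<in> I \<Longrightarrow> f * g \<in> I'"
  shows "em f * u \<in> Fil I' k"
  using assms(1)
proof induction
  case (Fil_step u g e)
  have "em f * (u + em g * nmon e) = em f * u + em (f * g) * nmon e"
    by (simp add: distrib_left em_mult mult.assoc)
  thus ?case using Fil_step assms(2) by (auto intro: Fil.Fil_step)
qed (simp add: Fil.Fil_zero)

lemma Fil_uminus:
  assumes "u \<in> Fil I k" "\<And>g. g \<in> I \<Longrightarrow> - g \<in> I"
  shows "- u \<in> Fil I k"
  using Fil_em_mult[of u I k "-1" I] assms by (simp add: em_minus em_one)

lemma Fil_diff:
  "u \<in> Fil I k \<Longrightarrow> v \<in> Fil I k \<Longrightarrow> (\<And>g. g \<in> I \<Longrightarrow> - g \<in> I) \<Longrightarrow> u - v \<in> Fil I k"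
  using Fil_add[of u I k "- v"] Fil_uminus[of v I k] by simp

lemma Fil_sum_list: "(\<And>w. w \<in> set ws \<Longrightarrow> f w \<in> Fil I k) \<Longrightarrow> (\<Sum>w\<leftarrow>ws. f w) \<in> Fil I k"
  by (induction ws) (auto intro: Fil_zero Fil_add)

text \<open>Every correction of the reordering lowers one exponent of \<open>e\<close>, so its
  weight is below that of \<open>e\<close> and hence below that of \<open>inc v e\<close>.\<close>

lemma gen_mult_mon: "t v * nmon e - nmon (inc v e) \<in> Fil UNIV (weight (inc v e))"
proof -
  have "(\<Sum>w\<leftarrow>takeWhile (\<lambda>w. w \<noteq> v) vs. em (of_nat (e w) * c v w) * nmon (e(w := e w - 1)))
    \<in> Fil UNIV (weight (inc v e))"
  proof (rule Fil_sum_list)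
    fix w
    show "em (of_nat (e w) * c v w) * nmon (e(w := e w - 1)) \<in> Fil UNIV (weight (inc v e))"
    \<comment> \<open>If \<open>e w = 0\<close>, truncated subtraction lowers nothing, but the
      coefficient \<open>em 0\<close> removes the term.\<close>
    proof (cases "e w = 0")
      case False
      hence "weight (e(w := e w - 1)) < weight e" by (intro weight_dec) simp
      also have "\<dots> < weight (inc v e)" using p_gt_1 weight_pos by (simp add: weight_inc)
      finally show ?thesis by (intro Fil_single) auto
    qed (simp add: em_zero Fil_zero)
  qed
  thus ?thesis using lmon_gen_mult[of vs v e] vs by simp
qed

text \<open>Multiplication by \<open>t v\<close> scales top weights by \<open>p v\<close>; the
  corrections are lower and keep their coefficients in \<open>I\<close>, as these are multiples of
  the old ones.\<close>

lemma gen_mult_Fil: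
  assumes "u \<in> Fil I k" "\<And>g r. g \<in> I \<Longrightarrow> g * r \<in> I"
  shows "t v * u \<in> Fil I (p v * k)"
  using assms(1)
proof induction
  case (Fil_step u f e)
  have k: "weight (inc v e) < p v * k"
    using Fil_step.hyps p_gt_1[of v] by (simp add: weight_inc)
  have "em f * (t v * nmon e - nmon (inc v e)) \<in> Fil I (p v * k)"
    using Fil_mono[OF gen_mult_mon, of UNIV] k Fil_step.hyps assms(2)
    by (intro Fil_em_mult[of _ UNIV]) auto
  hence "t v * u + em f * (t v * nmon e - nmon (inc v e)) + em f * nmon (inc v e) \<in> Fil I (p v * k)"
    using Fil_step k by (intro Fil.Fil_step Fil_add)
  moreover have "t v * (em f * nmon e) = em f * (t v * nmon e)"
    by (rule em_left_commute)
  ultimately show ?case by (simp add: algebra_simps)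
qed (simp add: Fil.Fil_zero)

text \<open>By injectivity of \<open>weight\<close> at most one exponent has weight exactly
  \<open>k\<close>, so all top terms merge into one.\<close>

lemma Fil_Suc_cases:
  assumes "u \<in> Fil I (Suc k)" "0 \<in> I" "\<forall>f\<in>I. \<forall>g\<in>I. f + g \<in> I"
  obtains "u \<in> Fil I k" | e f where "weight e = k" "f \<in> I" "u - em f * nmon e \<in> Fil I k"
proof -
  have "u \<in> Fil I k \<or> (\<exists>e f. weight e = k \<and> f \<in> I \<and> u - em f * nmon e \<in> Fil I k)"
    using assms(1)
  proof induction
    case (Fil_step u f e)
    show ?case
    proof (cases "weight e = k")
      case True
      from Fil_step.IH show ?thesis
      proof
        assume "u \<in> Fil I k"
        thus ?thesis using True Fil_step.hyps by (intro disjI2 exI[of _ e] exI[of _ f]) simp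
      next
        assume "\<exists>e f. weight e = k \<and> f \<in> I \<and> u - em f * nmon e \<in> Fil I k"
        then obtain g where g: "g \<in> I" "u - em g * nmon e \<in> Fil I k"
          using True weight_inj by metis
        have "u + em f * nmon e - em (f + g) * nmon e \<in> Fil I k"
          using g(2) by (simp add: em_add algebra_simps)
        thus ?thesis using True g(1) assms(3) Fil_step.hyps by blast
      qed
    next
      case False
      hence "weight e < k" using Fil_step.hyps by simp
      from Fil.Fil_step[OF _ \<open>f \<in> I\<close> this] Fil_step.IH show ?thesis
        by (metis add_diff_eq add.commute)
    qed
  qed (simp add: Fil.Fil_zero)
  thus thesis using that by blast
qed

section \<open>Leading coefficients and descent\<close>

text \<open>A relation rather than a function, since an element may have several expansions; the
  coefficient \<open>f\<close> may be zero.\<close>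

definition leading :: "'r set \<Rightarrow> 'a \<Rightarrow> ('v \<Rightarrow> nat) \<Rightarrow> bool" where
  "leading L f e \<longleftrightarrow> (\<exists>u\<in>L. u - em f * nmon e \<in> Fil UNIV (weight e))"

text \<open>Multiply the witness by \<open>t v\<close> on the left: its lower terms stay lower, and
  reordering the top term produces only lower corrections.\<close>

lemma leading_inc:
  assumes "\<And>u r. u \<in> L \<Longrightarrow> r * u \<in> L" "leading L f e"
  shows "leading L f (inc v e)"
proof -
  from assms(2) obtain u where u: "u \<in> L" "u - em f * nmon e \<in> Fil UNIV (weight e)"
    by (auto simp: leading_def)
  have "t v * (u - em f * nmon e) \<in> Fil UNIV (weight (inc v e))"
    unfolding weight_inc by (rule gen_mult_Fil[OF u(2)]) simp
  moreover have "em f * (t v * nmon e - nmon (inc v e)) \<in> Fil UNIV (weight (inc v e))"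
    by (rule Fil_em_mult[OF gen_mult_mon]) simp
  moreover have "t v * (em f * nmon e) = em f * (t v * nmon e)"
    by (rule em_left_commute)
  ultimately have "t v * u - em f * nmon (inc v e) \<in> Fil UNIV (weight (inc v e))"
    using Fil_add by (fastforce simp: algebra_simps)
  thus ?thesis using assms(1) u(1) by (auto simp: leading_def)
qed

lemma leading_mono:
  assumes "\<And>u r. u \<in> L \<Longrightarrow> r * u \<in> L" "leading L f g" "g \<le> e"
  shows "leading L f e"
  using assms(3)
proof (induction "sum e UNIV" arbitrary: e rule: less_induct)
  case less
  show ?case
  proof (cases "g = e")
    case False
    then obtain v where v: "g v < e v" by (metis less.prems le_funD le_neq_implies_less ext)
    let ?e = "e(v := e v - 1)"
    have "sum ?e UNIV < sum e UNIV"
      using v by (intro sum_strict_mono_ex1) auto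
    moreover have "g \<le> ?e" using v less.prems by (auto simp: le_fun_def)
    ultimately have "leading L f (inc v ?e)"
      using less.hyps by (intro leading_inc[OF assms(1)]) auto
    thus ?thesis using v by simp
  qed (use assms(2) in simp)
qed

text \<open>Cancelling the top term against an element of \<open>L\<close> whose leading coefficient is not in \<open>m\<close>
  keeps the element congruent modulo \<open>m\<close> to a constant outside \<open>m\<close>.\<close>

lemma descent:
  assumes L: "left_ideal L (ring_of_type_algebra :: 'r ring)"
    and m: "primeideal m (ring_of_type_algebra :: 'a ring)"
    and const: "\<And>f. em f \<in> L \<Longrightarrow> f \<in> m"
    and lead: "\<And>f e. leading L f e \<Longrightarrow> em f \<notin> L \<Longrightarrow> \<exists>g. leading L g e \<and> g \<notin> m"
    and "u \<in> L" "u - em a \<in> Fil m k" "a \<notin> m"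
  shows False
  using assms(5-7)
proof (induction k arbitrary: u a)
  case 0
  \<comment> \<open>\<open>Fil m 0\<close> contains only 0, so the element is the constant itself,
    and \<open>const\<close> puts \<open>a\<close> into \<open>m\<close>.\<close>
  hence "u = em a" by (auto elim: Fil.cases)
  thus False using const 0 by blast
next
  case (Suc k)
  have L0: "0 \<in> L" and Ladd: "\<And>u v. u \<in> L \<Longrightarrow> v \<in> L \<Longrightarrow> u + v \<in> L"
    and Lmult: "\<And>u r. u \<in> L \<Longrightarrow> r * u \<in> L"
    using L by (auto simp: left_ideal_type_iff)
  have Lneg: "\<And>u. u \<in> L \<Longrightarrow> - u \<in> L" using Lmult[of _ "-1"] by simp
  have Ldiff: "\<And>u v. u \<in> L \<Longrightarrow> v \<in> L \<Longrightarrow> u - v \<in> L"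
    using Ladd Lneg by (metis add_uminus_conv_diff)
  have m0: "0 \<in> m" and madd: "\<And>f g. f \<in> m \<Longrightarrow> g \<in> m \<Longrightarrow> f + g \<in> m"
    and mmult: "\<And>f r. f \<in> m \<Longrightarrow> r * f \<in> m"
    and mprime: "\<And>f g. f * g \<in> m \<Longrightarrow> f \<in> m \<or> g \<in> m"
    using m by (auto simp: primeideal_type_iff)
  have mneg: "\<And>f. f \<in> m \<Longrightarrow> - f \<in> m" using mmult[of _ "-1"] by simp
  have mmult': "\<And>f r. f \<in> m \<Longrightarrow> f * r \<in> m" using mmult by (simp add: mult.commute)
  have "\<forall>f\<in>m. \<forall>g\<in>m. f + g \<in> m" using madd by blast
  from Fil_Suc_cases[OF Suc.prems(2) m0 this] show False
  proof cases
    case 1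
    thus False using Suc by blast
  next
    case (2 e f)
    show False
    \<comment> \<open>A constant top term, with coefficient in \<open>m\<close>, is absorbed into
      \<open>a\<close>, which stays outside \<open>m\<close>.\<close>
    proof (cases "e = (\<lambda>_. 0)")
      case True
      have "u - em (a + f) \<in> Fil m k"
        using 2(3) by (simp add: True nmon_zero em_add algebra_simps)
      moreover have "a + f \<notin> m"
        using madd[of "a + f" "- f"] mneg[OF 2(2)] Suc.prems(3) by auto
      ultimately show False using Suc by blast
    next
      case False
      hence "weight e \<noteq> weight (\<lambda>_. 0)" by (simp add: weight_inj)
      hence k: "k > 1" using 2(1) weight_pos[of e] weight_zero by linarith
      show False
      proof (cases "em f \<in> L")
        case True
        hence "nmon e * em f \<in> L" by (rule Lmult)
        hence "u - em f * nmon e \<in> L" using Ldiff Suc.prems(1) by (simp add: em_central)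
        moreover have "u - em f * nmon e - em a \<in> Fil m k"
          using 2(3) by (simp add: algebra_simps)
        ultimately show False using Suc by blast
      next
        case False
        have "u - em f * nmon e - em a \<in> Fil UNIV k"
          using Fil_mono[OF 2(3)] by (simp add: algebra_simps)
        \<comment> \<open>Since \<open>k > 1\<close>, the constant \<open>em a\<close> counts among
          the lower terms, so \<open>f\<close> is a leading coefficient of \<open>u\<close> at
          \<open>e\<close>.\<close>
        moreover have "em a \<in> Fil UNIV k"
          using Fil_single[of a UNIV "\<lambda>_. 0" k] k by (simp add: nmon_zero weight_zero)
        ultimately have "u - em f * nmon e - em a + em a \<in> Fil UNIV k"
          by (rule Fil_add)
        hence "leading L f e" using Suc.prems(1) 2(1) by (auto simp: leading_def)
        then obtain g w where g: "g \<notin> m" "w \<in> L" "w - em g * nmon e \<in> Fil UNIV k"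
          using lead[of f e] False 2(1) by (auto simp: leading_def)
        \<comment> \<open>Cross-multiplication cancels the top terms of \<open>u\<close> and
          \<open>w\<close>. The lower terms of \<open>w\<close> acquire the factor \<open>f\<close>
          in \<open>m\<close>, and the new constant \<open>g * a\<close> avoids \<open>m\<close> by
          primality.\<close>
        have "em g * (u - em a - em f * nmon e) \<in> Fil m k"
          using 2(3) by (rule Fil_em_mult) (rule mmult)
        moreover have "em f * (w - em g * nmon e) \<in> Fil m k"
          using g(3) by (rule Fil_em_mult) (rule mmult'[OF 2(2)])
        ultimately have "em g * (u - em a - em f * nmon e) - em f * (w - em g * nmon e) \<in> Fil m k"
          by (rule Fil_diff) (rule mneg)
        moreover have "em g * (u - em a - em f * nmon e) - em f * (w - em g * nmon e) =
          em g * u - em f * w - em (g * a)"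
        proof -
          have "em g * (em f * nmon e) = em f * (em g * nmon e)"
            by (rule em_left_commute)
          thus ?thesis by (simp add: right_diff_distrib em_mult)
        qed
        ultimately have "em g * u - em f * w - em (g * a) \<in> Fil m k" by simp
        moreover have "em g * u - em f * w \<in> L" using g(2) Suc.prems(1) Ldiff Lmult by blast
        moreover have "g * a \<notin> m" using mprime g(1) Suc.prems(3) by blast
        ultimately show False using Suc.IH by blast
      qed
    qed
  qed
qed

text \<open>With \<open>h\<close> the product of chosen leading coefficients at the Dickson
  generators, \<open>h\<close> outside \<open>m\<close> forces every factor outside
  \<open>m\<close>. Propagation of leading coefficients to larger exponents then supplies the
  reducers for \<open>descent\<close>.\<close>

lemma generic_nonmembership:
  assumes L: "left_ideal L (ring_of_type_algebra :: 'r ring)"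
    and P: "primeideal P (ring_of_type_algebra :: 'a ring)"
    and contr: "\<And>f. em f \<in> L \<longleftrightarrow> f \<in> P"
  obtains h where "h \<notin> P"
    "\<And>m u k. primeideal m (ring_of_type_algebra :: 'a ring) \<Longrightarrow> P \<subseteq> m \<Longrightarrow> h \<notin> m \<Longrightarrow>
       u \<in> L \<Longrightarrow> u - 1 \<notin> Fil m k"
proof -
  define E where "E = {e. \<exists>f. f \<notin> P \<and> leading L f e}"
  obtain G where G: "G \<subseteq> E" "finite G" "\<And>e. e \<in> E \<Longrightarrow> \<exists>g\<in>G. g \<le> e"
    using dickson[of E] by blast
  obtain a where a: "\<And>g. g \<in> G \<Longrightarrow> a g \<notin> P \<and> leading L (a g) g"
    using G(1) unfolding E_def subset_iff mem_Collect_eq by metis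
  have Pprime: "1 \<notin> P" "\<And>f g. f * g \<in> P \<Longrightarrow> f \<in> P \<or> g \<in> P"
    using P by (auto simp: primeideal_type_iff)
  have "prod a G \<notin> P"
    using G(2) a by (induction G rule: finite_induct) (use Pprime in auto)
  moreover have "u - 1 \<notin> Fil m k"
    if m: "primeideal m (ring_of_type_algebra :: 'a ring)" and Pm: "P \<subseteq> m" "prod a G \<notin> m"
      and u: "u \<in> L" for m u k
  proof
    assume Fil: "u - 1 \<in> Fil m k"
    have mmult: "\<And>f r. f \<in> m \<Longrightarrow> r * f \<in> m" "1 \<notin> m"
      using m by (auto simp: primeideal_type_iff)
    have am: "a g \<notin> m" if "g \<in> G" for g
      using mmult(1)[of "a g" "prod a (G - {g})"] Pm(2) G(2) that
      by (auto simp: prod.remove[of G g] mult.commute)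
    show False
    proof (rule descent[OF L m])
      fix f e assume "leading L f e" "em f \<notin> L"
      hence "e \<in> E" using contr by (auto simp: E_def)
      then obtain g where "g \<in> G" "g \<le> e" using G(3) by blast
      thus "\<exists>g. leading L g e \<and> g \<notin> m"
        using L a am leading_mono[of L "a g" g e] by (auto simp: left_ideal_type_iff)
    next
      show "u - em 1 \<in> Fil m k" using Fil by (simp add: em_one)
    qed (use contr Pm u mmult in auto)
  qed
  ultimately show thesis by (rule that)
qed

section \<open>Contraction to the minimal prime and specialization\<close>

text \<open>A left ideal maximal among those whose contraction avoids a multiplicative set has prime
  contraction, as in the commutative case.\<close>

lemma left_ideal_contracting_to_minimal_prime:
  assumes J: "left_ideal J (ring_of_type_algebra :: 'r ring)"
    and P: "minimal_prime P {f. em f \<in> J} (ring_of_type_algebra :: 'a ring)"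
  obtains L where "left_ideal L (ring_of_type_algebra :: 'r ring)" "J \<subseteq> L" "\<And>f. em f \<in> L \<longleftrightarrow> f \<in> P"
proof -
  let ?R = "ring_of_type_algebra :: 'r ring" and ?A = "ring_of_type_algebra :: 'a ring"
  define \<L> where "\<L> = {L. left_ideal L ?R \<and> J \<subseteq> L \<and> em -` L \<subseteq> P}"
  have P': "1 \<notin> P" "\<And>f g. f * g \<in> P \<Longrightarrow> f \<in> P \<or> g \<in> P"
    using P by (auto simp: minimal_prime_def primeideal_type_iff)
  have J\<L>: "J \<in> \<L>" using J P by (auto simp: \<L>_def minimal_prime_def)
  have "\<exists>L\<in>\<L>. \<forall>K\<in>\<L>. L \<subseteq> K \<longrightarrow> K = L"
  proof (rule subset_Zorn_nonempty)
    fix \<C> assume \<C>: "\<C> \<noteq> {}" "subset.chain \<L> \<C>"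
    have left: "0 \<in> C" "a \<in> C \<Longrightarrow> b \<in> C \<Longrightarrow> a + b \<in> C" "a \<in> C \<Longrightarrow> r * a \<in> C"
      and between: "J \<subseteq> C" "em -` C \<subseteq> P" if "C \<in> \<C>" for C a b r
      using that \<C>(2) by (auto simp: \<L>_def subset_chain_def left_ideal_type_iff)
    have linear: "C \<subseteq> D \<or> D \<subseteq> C" if "C \<in> \<C>" "D \<in> \<C>" for C D
      using that \<C>(2) by (auto simp: subset_chain_def)
    obtain C where C: "C \<in> \<C>" using \<C>(1) by blast
    have "left_ideal (\<Union>\<C>) ?R"
      unfolding left_ideal_type_iff
    proof (intro conjI ballI allI)
      show "0 \<in> \<Union>\<C>" using C left(1)[OF C] by blast
    next
      fix a b assume "a \<in> \<Union>\<C>" "b \<in> \<Union>\<C>"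
      then obtain D D' where D: "D \<in> \<C>" "a \<in> D" "D' \<in> \<C>" "b \<in> D'" by blast
      from linear[OF D(1,3)] have "(a \<in> D \<and> b \<in> D) \<or> (a \<in> D' \<and> b \<in> D')" using D by blast
      with D(1,3) show "a + b \<in> \<Union>\<C>" using left(2) by blast
    next
      fix a r assume "a \<in> \<Union>\<C>"
      thus "r * a \<in> \<Union>\<C>" using left(3) by blast
    qed
    moreover have "J \<subseteq> \<Union>\<C>" using C between(1) by blast
    moreover have "em -` \<Union>\<C> \<subseteq> P" using between(2) by blast
    ultimately show "\<Union>\<C> \<in> \<L>" by (simp add: \<L>_def)
  qed (use J\<L> in blast)
  then obtain L where L: "L \<in> \<L>" "\<And>K. K \<in> \<L> \<Longrightarrow> L \<subseteq> K \<Longrightarrow> K = L" by blast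
  have L0: "0 \<in> L" and Ladd: "\<And>u v. u \<in> L \<Longrightarrow> v \<in> L \<Longrightarrow> u + v \<in> L"
    and Lmult: "\<And>u r. u \<in> L \<Longrightarrow> r * u \<in> L"
    using L(1) by (auto simp: \<L>_def left_ideal_type_iff)
  \<comment> \<open>Otherwise \<open>L + em a R\<close>, a left ideal because \<open>em a\<close> is
    central, would still contract into \<open>P\<close>; by maximality it would equal
    \<open>L\<close> and contain \<open>em a\<close>.\<close>
  have avoid: "\<exists>s u r. s \<notin> P \<and> u \<in> L \<and> em s = u + em a * r" if "em a \<notin> L" for a
  proof (rule ccontr)
    assume contra: "\<not> ?thesis"
    define K where "K = {u + em a * r |u r. u \<in> L}"
    have "left_ideal K ?R"
      unfolding left_ideal_type_iff
    proof (intro conjI ballI allI)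
      have "0 = 0 + em a * 0" by simp
      thus "0 \<in> K" unfolding K_def using L0 by blast
    next
      fix x y assume "x \<in> K" "y \<in> K"
      then obtain u r u' r' where "x = u + em a * r" "y = u' + em a * r'" "u \<in> L" "u' \<in> L"
        by (auto simp: K_def)
      hence "x + y = (u + u') + em a * (r + r')" "u + u' \<in> L"
        using Ladd by (auto simp: algebra_simps)
      thus "x + y \<in> K" unfolding K_def by blast
    next
      fix x s assume "x \<in> K"
      then obtain u r where "x = u + em a * r" "u \<in> L" by (auto simp: K_def)
      hence "s * x = s * u + em a * (s * r)" "s * u \<in> L"
        using Lmult by (simp_all add: distrib_left em_left_commute)
      thus "s * x \<in> K" unfolding K_def by blast
    qed
    moreover have LK: "L \<subseteq> K"
    proof
      fix u assume "u \<in> L"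
      moreover have "u = u + em a * 0" by simp
      ultimately show "u \<in> K" unfolding K_def by blast
    qed
    moreover have "em -` K \<subseteq> P" using contra by (auto simp: K_def)
    moreover have "J \<subseteq> L" using L(1) by (simp add: \<L>_def)
    ultimately have "K \<in> \<L>" by (auto simp: \<L>_def)
    hence "K = L" using L(2) LK by blast
    moreover have "em a = 0 + em a * 1" by simp
    hence "em a \<in> K" unfolding K_def using L0 by blast
    ultimately show False using that by simp
  qed
  have "primeideal (em -` L) ?A"
    unfolding primeideal_type_iff
  proof (intro conjI allI impI ballI)
    show "1 \<notin> em -` L" using L(1) P' by (auto simp: \<L>_def)
    fix a b assume ab: "a * b \<in> em -` L"
    show "a \<in> em -` L \<or> b \<in> em -` L"
    proof (rule ccontr)
      assume "\<not> ?thesis"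
      then obtain s u r s' u' r' where s: "s \<notin> P" "u \<in> L" "em s = u + em a * r"
        and s': "s' \<notin> P" "u' \<in> L" "em s' = u' + em b * r'"
        using avoid[of a] avoid[of b] by auto
      \<comment> \<open>Centrality lets the product be written with \<open>u\<close>,
        \<open>u'\<close> and \<open>em (a * b)\<close> as rightmost factors, so a left ideal
        containing these contains the product.\<close>
      have "em (s * s') = em s' * em s"
        by (simp only: em_mult mult.commute[of s])
      also have "\<dots> = em s' * u + em a * (em s' * r)"
        by (simp only: s(3) distrib_left em_left_commute[of "em s'" a])
      also have "em s' * r = r * u' + em b * (r * r')"
        unfolding em_central[of s'] unfolding s'(3) by (simp only: distrib_left em_left_commute[of r b])
      also have "em a * (r * u' + em b * (r * r')) = (em a * r) * u' + (r * r') * em (a * b)"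
        unfolding em_central[of "a * b", symmetric] by (simp only: distrib_left em_mult mult.assoc)
      finally have "em (s * s') \<in> L"
        using s s' ab Lmult Ladd by simp
      hence "s * s' \<in> P" using L(1) by (auto simp: \<L>_def)
      thus False using P'(2) s(1) s'(1) by blast
    qed
  qed (use L0 Ladd Lmult in \<open>auto simp: em_zero em_add em_mult\<close>)
  moreover have "{f. em f \<in> J} \<subseteq> em -` L" "em -` L \<subseteq> P" using L(1) by (auto simp: \<L>_def)
  ultimately have "em -` L = P" using P by (auto simp: minimal_prime_def)
  thus thesis using that[of L] L(1) by (auto simp: \<L>_def)
qed

text \<open>\<open>T\<close> is J + mR. Spanning identifies the elements of mR with those having an
  expansion with coefficients in \<open>m\<close>; if 1 were in \<open>T\<close>, some element of
  \<open>J\<close> would be 1 modulo such an expansion, contrary to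
  \<open>generic_nonmembership\<close>.\<close>

lemma generic_specialization_proper:
  assumes span: "\<And>u. \<exists>k. u \<in> Fil UNIV k"
    and J: "left_ideal J (ring_of_type_algebra :: 'r ring)"
    and P: "minimal_prime P {f. em f \<in> J} (ring_of_type_algebra :: 'a ring)"
  obtains h where "h \<notin> P"
    "\<And>m. primeideal m (ring_of_type_algebra :: 'a ring) \<Longrightarrow> P \<subseteq> m \<Longrightarrow> h \<notin> m \<Longrightarrow>
       \<exists>T. left_ideal T (ring_of_type_algebra :: 'r ring) \<and> J \<subseteq> T \<and> em ` m \<subseteq> T \<and> 1 \<notin> T"
proof -
  obtain L where L: "left_ideal L (ring_of_type_algebra :: 'r ring)" "J \<subseteq> L" "\<And>f. em f \<in> L \<longleftrightarrow> f \<in> P"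
    using left_ideal_contracting_to_minimal_prime[OF J P] by blast
  have "primeideal P (ring_of_type_algebra :: 'a ring)"
    using P by (simp add: minimal_prime_def)
  then obtain h where h: "h \<notin> P"
    "\<And>m u k. primeideal m (ring_of_type_algebra :: 'a ring) \<Longrightarrow> P \<subseteq> m \<Longrightarrow> h \<notin> m \<Longrightarrow>
       u \<in> L \<Longrightarrow> u - 1 \<notin> Fil m k"
    using generic_nonmembership[OF L(1) _ L(3)] by blast
  have "\<exists>T. left_ideal T (ring_of_type_algebra :: 'r ring) \<and> J \<subseteq> T \<and> em ` m \<subseteq> T \<and> 1 \<notin> T"
    if m: "primeideal m (ring_of_type_algebra :: 'a ring)" "P \<subseteq> m" "h \<notin> m" for m
  proof -
    have m0: "0 \<in> m" and mmult: "\<And>f r. f \<in> m \<Longrightarrow> r * f \<in> m"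
      using m(1) by (auto simp: primeideal_type_iff)
    have mmult': "\<And>f r. f \<in> m \<Longrightarrow> f * r \<in> m" using mmult by (simp add: mult.commute)
    have mneg: "\<And>f. f \<in> m \<Longrightarrow> - f \<in> m" using mmult[of _ "-1"] by simp
    have Fil_add': "\<exists>k. u + v \<in> Fil m k" if "\<exists>k. u \<in> Fil m k" "\<exists>k. v \<in> Fil m k" for u v
      using that Fil_add Fil_mono by (metis max.cobounded1 max.cobounded2 subset_refl)
    have em_Fil: "\<exists>k. em f * r \<in> Fil m k" if "f \<in> m" for f r
    proof -
      obtain k where "r \<in> Fil UNIV k" using span by blast
      hence "em f * r \<in> Fil m k" by (rule Fil_em_mult) (rule mmult'[OF that])
      thus ?thesis by blast
    qed
    \<comment> \<open>The central coefficient moves to the front and \<open>r * nmon e\<close> is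
      expanded anew, so all coefficients remain in \<open>m\<close>.\<close>
    have Fil_mult: "\<exists>k. r * w \<in> Fil m k" if "w \<in> Fil m k" for r w k
      using that
    proof induction
      case (Fil_step u f e)
      have "r * (u + em f * nmon e) = r * u + em f * (r * nmon e)"
        by (simp only: distrib_left em_left_commute)
      thus ?case using Fil_add' em_Fil Fil_step by metis
    qed (auto intro: Fil_zero)
    define T where "T = {v + w |v w. v \<in> J \<and> (\<exists>k. w \<in> Fil m k)}"
    have J0: "0 \<in> J" and Jadd: "\<And>u v. u \<in> J \<Longrightarrow> v \<in> J \<Longrightarrow> u + v \<in> J"
      and Jmult: "\<And>u r. u \<in> J \<Longrightarrow> r * u \<in> J"
      using J by (auto simp: left_ideal_type_iff)
    have TI: "v + w \<in> T" if "v \<in> J" "\<exists>k. w \<in> Fil m k" for v w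
      using that unfolding T_def by blast
    have "left_ideal T (ring_of_type_algebra :: 'r ring)"
      unfolding left_ideal_type_iff
    proof (intro conjI ballI allI)
      show "0 \<in> T" using TI[OF J0, of 0] Fil_zero by auto
    next
      fix a b assume "a \<in> T" "b \<in> T"
      then obtain v w v' w' where *: "a = v + w" "b = v' + w'" "v \<in> J" "v' \<in> J"
        "\<exists>k. w \<in> Fil m k" "\<exists>k. w' \<in> Fil m k"
        unfolding T_def by blast
      have "(v + v') + (w + w') \<in> T" using * by (intro TI Jadd Fil_add')
      thus "a + b \<in> T" using * by (simp add: algebra_simps)
    next
      fix a r assume "a \<in> T"
      then obtain v w where *: "a = v + w" "v \<in> J" "\<exists>k. w \<in> Fil m k" unfolding T_def by blast
      have "r * v + r * w \<in> T" using * Fil_mult by (intro TI Jmult) auto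
      thus "r * a \<in> T" using * by (simp add: distrib_left)
    qed
    moreover have "J \<subseteq> T" using TI[of _ 0] Fil_zero by auto
    moreover have "em ` m \<subseteq> T" using TI[OF J0] em_Fil[of _ 1] by auto
    moreover have "1 \<notin> T"
    proof
      assume "1 \<in> T"
      then obtain v w k where *: "1 = v + w" "v \<in> J" "w \<in> Fil m k" unfolding T_def by blast
      have "- w \<in> Fil m k" using *(3) mneg by (rule Fil_uminus)
      moreover have "- w = v - 1" using *(1) by (simp add: algebra_simps)
      ultimately show False using h(2)[OF m, of v k] L(2) *(2) by auto
    qed
    ultimately show ?thesis by blast
  qed
  with h(1) show thesis by (rule that)
qed

end

section \<open>Evaluation of polynomials\<close>

lemma cpoly_eval_superset:
  assumes "finite S" "Poly_Mapping.keys f \<subseteq> S"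
  shows "cpoly_eval \<alpha> f =
    (\<Sum>m\<in>S. Poly_Mapping.lookup f m * (\<Prod>i\<in>UNIV. \<alpha> i ^ Poly_Mapping.lookup m i))"
  unfolding cpoly_eval_def using assms
  by (intro sum.mono_neutral_left) (auto simp: in_keys_iff)

lemma cpoly_eval_add: "cpoly_eval \<alpha> (f + g) = cpoly_eval \<alpha> f + cpoly_eval \<alpha> g"
proof -
  let ?S = "Poly_Mapping.keys f \<union> Poly_Mapping.keys g"
  have "Poly_Mapping.keys (f + g) \<subseteq> ?S" by (rule Poly_Mapping.keys_add)
  thus ?thesis
    by (simp add: cpoly_eval_superset[of ?S] lookup_add sum.distrib distrib_right)
qed

lemma cpoly_eval_single:
  "cpoly_eval \<alpha> (Poly_Mapping.single m c) = c * (\<Prod>i\<in>UNIV. \<alpha> i ^ Poly_Mapping.lookup m i)"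
  by (simp add: cpoly_eval_def)

lemma cpoly_eval_mult: "cpoly_eval \<alpha> (f * g) = cpoly_eval \<alpha> f * cpoly_eval \<alpha> g"
proof (induction f rule: poly_mapping_add_induct)
  case (1 k c)
  show ?case
    by (induction g rule: poly_mapping_add_induct)
       (simp_all add: Poly_Mapping.mult_single cpoly_eval_single cpoly_eval_add distrib_left
         lookup_add power_add prod.distrib)
qed (simp add: distrib_right cpoly_eval_add)

lemma cpoly_eval_one: "cpoly_eval \<alpha> 1 = 1"
  using cpoly_eval_single[of \<alpha> 0 1] by simp

lemma primeideal_point_ideal: "primeideal (point_ideal \<alpha>) cpoly_ring"
  by (simp add: primeideal_type_iff point_ideal_def cpoly_eval_add cpoly_eval_mult cpoly_eval_one)
    (simp add: cpoly_eval_def)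


section \<open>Nonvanishing of the tensor product\<close>

lemma carrier_quotient_restrict_scalars:
  "carrier (quotient_module (restrict_scalars \<phi> (ring_of_type_algebra :: 'r::ring_1 ring)) I) =
     range (\<lambda>u. {j + u |j. j \<in> I})"
  by (auto simp: quotient_module_def restrict_scalars_def A_RCOSETS_def RCOSETS_def r_coset_def
      image_iff)

lemma add_quotient_restrict_scalars:
  "x \<oplus>\<^bsub>quotient_module (restrict_scalars \<phi> (ring_of_type_algebra :: 'r::ring_1 ring)) I\<^esub> y =
     {a + b |a b. a \<in> x \<and> b \<in> y}"
  by (auto simp: quotient_module_def restrict_scalars_def set_add_def set_mult_def)

lemma smult_quotient_restrict_scalars:
  "a \<odot>\<^bsub>quotient_module (restrict_scalars \<phi> (ring_of_type_algebra :: 'r::ring_1 ring)) I\<^esub> x =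
     {j + \<phi> a * u |j u. j \<in> I \<and> u \<in> x}"
  by (auto simp: quotient_module_def restrict_scalars_def a_r_coset_def r_coset_def)

lemmas quotient_restrict_scalars_simps =
  carrier_quotient_restrict_scalars add_quotient_restrict_scalars smult_quotient_restrict_scalars

text \<open>The additive extension of \<phi> from the generators to the free abelian group.\<close>

definition frag_eval :: "('k \<Rightarrow> 'r::ring_1) \<Rightarrow> ('k \<Rightarrow>\<^sub>0 int) \<Rightarrow> 'r" where
  "frag_eval \<phi> c = (\<Sum>k\<in>Poly_Mapping.keys c. of_int (Poly_Mapping.lookup c k) * \<phi> k)"

lemma frag_eval_superset:
  assumes "finite S" "Poly_Mapping.keys c \<subseteq> S"
  shows "frag_eval \<phi> c = (\<Sum>k\<in>S. of_int (Poly_Mapping.lookup c k) * \<phi> k)"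
  unfolding frag_eval_def using assms
  by (intro sum.mono_neutral_left) (auto simp: in_keys_iff)

lemma frag_eval_add: "frag_eval \<phi> (c + d) = frag_eval \<phi> c + frag_eval \<phi> d"
proof -
  let ?S = "Poly_Mapping.keys c \<union> Poly_Mapping.keys d"
  have "Poly_Mapping.keys (c + d) \<subseteq> ?S" by (rule Poly_Mapping.keys_add)
  thus ?thesis
    by (simp add: frag_eval_superset[of ?S] lookup_add sum.distrib distrib_right)
qed

lemma frag_eval_diff: "frag_eval \<phi> (c - d) = frag_eval \<phi> c - frag_eval \<phi> d"
  using frag_eval_add[of \<phi> "c - d" d] by simp

lemma frag_eval_zero: "frag_eval \<phi> 0 = 0"
  by (simp add: frag_eval_def)

lemma frag_eval_of: "frag_eval \<phi> (frag_of k) = \<phi> k"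
  by (simp add: frag_eval_def)

text \<open>In a trivial quotient the coset of a generator is the relator subgroup itself, and the
  generator lies in its own coset.\<close>

lemma tensor_product_trivialD:
  assumes trivial: "carrier (tensor_product A M N) = {\<one>\<^bsub>tensor_product A M N\<^esub>}"
    and k: "k \<in> carrier M \<times> carrier N"
  shows "frag_of k \<in> generate (free_Abelian_group (carrier M \<times> carrier N)) (tensor_relators A M N)"
proof -
  let ?F = "free_Abelian_group (carrier M \<times> carrier N)"
  let ?G = "generate ?F (tensor_relators A M N)"
  have "frag_of k \<in> carrier ?F" using k by (simp add: free_Abelian_group_def)
  hence "?G #>\<^bsub>?F\<^esub> frag_of k \<in> carrier (tensor_product A M N)"
    by (auto simp: tensor_product_def Let_def FactGroup_def RCOSETS_def)
  hence "?G #>\<^bsub>?F\<^esub> frag_of k = ?G"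
    using trivial by (simp add: tensor_product_def Let_def FactGroup_def)
  moreover have "\<one>\<^bsub>?F\<^esub> \<in> ?G" by (rule generate.one)
  hence "frag_of k \<in> ?G #>\<^bsub>?F\<^esub> frag_of k"
    by (force simp: r_coset_def free_Abelian_group_def)
  ultimately show ?thesis by simp
qed

text \<open>The bilinear map \<open>(x, y) \<mapsto> y x mod T\<close> is realised on coset representatives, which avoids
  forming the quotient by \<open>T\<close>.\<close>

lemma tensor_product_nontrivial:
  fixes J T :: "('n, 'p) weyl_poly set" and I :: "'p cpoly set"
  assumes J: "left_ideal J (weyl_poly_ring :: ('n, 'p) weyl_poly ring)"
    and I: "ideal I cpoly_ring"
    and T: "left_ideal T (weyl_poly_ring :: ('n, 'p) weyl_poly ring)"
    and sub: "J \<subseteq> T" "cpoly_embed ` I \<subseteq> T" and one: "1 \<notin> T"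
  shows "carrier (tensor_product cpoly_ring (weyl_poly_quotient J) (cpoly_quotient I)) \<noteq>
    {\<one>\<^bsub>tensor_product cpoly_ring (weyl_poly_quotient J) (cpoly_quotient I)\<^esub>}"
proof
  let ?M = "weyl_poly_quotient J" and ?N = "cpoly_quotient I"
  let ?F = "free_Abelian_group (carrier ?M \<times> carrier ?N)"
  let ?em = "cpoly_embed :: 'p cpoly \<Rightarrow> ('n, 'p) weyl_poly"
  define rep where "rep C = (SOME u. u \<in> C)" for C :: "('n, 'p) weyl_poly set"
  define rep' where "rep' C = (SOME u. u \<in> C)" for C :: "'p cpoly set"
  define \<phi> where "\<phi> = (\<lambda>(x, y). ?em (rep' y) * rep x)"
  assume trivial: "carrier (tensor_product cpoly_ring ?M ?N) = {\<one>\<^bsub>tensor_product cpoly_ring ?M ?N\<^esub>}"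
  have J0: "0 \<in> J" and Jadd: "\<And>u v. u \<in> J \<Longrightarrow> v \<in> J \<Longrightarrow> u + v \<in> J"
    and Jmult: "\<And>u r. u \<in> J \<Longrightarrow> r * u \<in> J"
    using J by (auto simp: left_ideal_type_iff)
  have T0: "0 \<in> T" and Tadd: "\<And>u v. u \<in> T \<Longrightarrow> v \<in> T \<Longrightarrow> u + v \<in> T"
    and Tmult: "\<And>u r. u \<in> T \<Longrightarrow> r * u \<in> T"
    using T by (auto simp: left_ideal_type_iff)
  have Tneg: "- u \<in> T" if "u \<in> T" for u using Tmult[OF that, of "-1"] by simp
  have Jneg: "- u \<in> J" if "u \<in> J" for u using Jmult[OF that, of "-1"] by simp
  have Jdiff: "u - v \<in> J" if "u \<in> J" "v \<in> J" for u v
    using Jadd[OF that(1) Jneg[OF that(2)]] by simp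
  have Tdiff: "u - v \<in> T" if "u \<in> T" "v \<in> T" for u v
    using Tadd[OF that(1) Tneg[OF that(2)]] by simp
  interpret I: ideal I cpoly_ring by (rule I)
  have I0: "0 \<in> I" and Iadd: "\<And>u v. u \<in> I \<Longrightarrow> v \<in> I \<Longrightarrow> u + v \<in> I"
    and Imult: "\<And>u r. u \<in> I \<Longrightarrow> r * u \<in> I"
    using additive_subgroup.zero_closed[OF I.additive_subgroup_axioms]
      additive_subgroup.a_closed[OF I.additive_subgroup_axioms] I.I_l_closed by auto
  have Ineg: "- u \<in> I" if "u \<in> I" for u using Imult[OF that, of "-1"] by simp
  have Idiff: "u - v \<in> I" if "u \<in> I" "v \<in> I" for u v
    using Iadd[OF that(1) Ineg[OF that(2)]] by simp
  \<comment> \<open>\<open>T\<close> is only a left ideal; centrality of \<open>?em f\<close> turns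
    this right multiple into a left one.\<close>
  have IT: "?em f * r \<in> T" if "f \<in> I" for f r
    unfolding cpoly_embed_central by (rule Tmult) (use sub(2) that in blast)
  have em_diff: "?em (f - g) = ?em f - ?em g" for f g
  proof -
    have "?em (f - g) + ?em g = ?em f" by (simp flip: cpoly_embed_add)
    thus ?thesis by (simp add: eq_diff_eq)
  qed
  have cosetM: "rep x \<in> x" "u \<in> x \<Longrightarrow> v \<in> x \<Longrightarrow> u - v \<in> J" if x: "x \<in> carrier ?M" for x u v
  proof -
    obtain w where w: "x = {j + w |j. j \<in> J}"
      using x unfolding weyl_poly_quotient_def carrier_quotient_restrict_scalars by (rule rangeE)
    thus "rep x \<in> x" unfolding rep_def using J0 by (intro someI_ex[of "\<lambda>u. u \<in> x"]) auto
    show "u - v \<in> J" if "u \<in> x" "v \<in> x" using that Jdiff by (auto simp: w)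
  qed
  have cosetN: "rep' y \<in> y" "u \<in> y \<Longrightarrow> v \<in> y \<Longrightarrow> u - v \<in> I" if y: "y \<in> carrier ?N" for y u v
  proof -
    obtain w where w: "y = {j + w |j. j \<in> I}"
      using y unfolding cpoly_quotient_def carrier_quotient_restrict_scalars by (rule rangeE)
    thus "rep' y \<in> y" unfolding rep'_def using I0 by (intro someI_ex[of "\<lambda>u. u \<in> y"]) auto
    show "u - v \<in> I" if "u \<in> y" "v \<in> y" using that Idiff by (auto simp: w)
  qed
  have someM: "rep x \<in> x" if "u \<in> x" for x u
    unfolding rep_def using that by (rule someI)
  have someN: "rep' x \<in> x" if "u \<in> x" for x u
    unfolding rep'_def using that by (rule someI)
  \<comment> \<open>Chosen representatives respect sums and scalars only up to \<open>J\<close> or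
    \<open>I\<close>; after multiplication by the other representative these errors lie in
    \<open>T\<close>.\<close>
  have relator: "frag_eval \<phi> c \<in> T" if "c \<in> tensor_relators cpoly_ring ?M ?N" for c
    using that unfolding tensor_relators_def
  proof (elim UnE CollectE exE conjE)
    fix x x' y
    assume c: "c = frag_of (x \<oplus>\<^bsub>?M\<^esub> x', y) - frag_of (x, y) - frag_of (x', y)"
      and *: "x \<in> carrier ?M" "x' \<in> carrier ?M" "y \<in> carrier ?N"
    have add: "x \<oplus>\<^bsub>?M\<^esub> x' = {a + b |a b. a \<in> x \<and> b \<in> x'}"
      by (simp add: weyl_poly_quotient_def quotient_restrict_scalars_simps)
    have "rep x + rep x' \<in> x \<oplus>\<^bsub>?M\<^esub> x'" using cosetM(1) * unfolding add by blast
    hence "rep (x \<oplus>\<^bsub>?M\<^esub> x') \<in> x \<oplus>\<^bsub>?M\<^esub> x'" by (rule someM)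
    then obtain a b where ab: "a \<in> x" "b \<in> x'" "rep (x \<oplus>\<^bsub>?M\<^esub> x') = a + b" unfolding add by blast
    have "(a - rep x) + (b - rep x') \<in> J"
      using cosetM * ab by (intro Jadd) blast+
    hence "?em (rep' y) * ((a - rep x) + (b - rep x')) \<in> T" using Tmult sub(1) by blast
    thus "frag_eval \<phi> c \<in> T"
      by (simp add: c frag_eval_add frag_eval_diff frag_eval_of \<phi>_def ab(3) algebra_simps)
  next
    fix x y y'
    assume c: "c = frag_of (x, y \<oplus>\<^bsub>?N\<^esub> y') - frag_of (x, y) - frag_of (x, y')"
      and *: "x \<in> carrier ?M" "y \<in> carrier ?N" "y' \<in> carrier ?N"
    have add: "y \<oplus>\<^bsub>?N\<^esub> y' = {a + b |a b. a \<in> y \<and> b \<in> y'}"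
      by (simp add: cpoly_quotient_def quotient_restrict_scalars_simps)
    have "rep' y + rep' y' \<in> y \<oplus>\<^bsub>?N\<^esub> y'" using cosetN(1) * unfolding add by blast
    hence "rep' (y \<oplus>\<^bsub>?N\<^esub> y') \<in> y \<oplus>\<^bsub>?N\<^esub> y'" by (rule someN)
    then obtain a b where ab: "a \<in> y" "b \<in> y'" "rep' (y \<oplus>\<^bsub>?N\<^esub> y') = a + b" unfolding add by blast
    have "(a - rep' y) + (b - rep' y') \<in> I"
      using cosetN * ab by (intro Iadd) blast+
    hence "?em ((a - rep' y) + (b - rep' y')) * rep x \<in> T" by (rule IT)
    thus "frag_eval \<phi> c \<in> T"
      by (simp add: c frag_eval_add frag_eval_diff frag_eval_of \<phi>_def ab(3) cpoly_embed_add em_diff algebra_simps)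
  next
    fix a x y
    assume c: "c = frag_of (a \<odot>\<^bsub>?M\<^esub> x, y) - frag_of (x, a \<odot>\<^bsub>?N\<^esub> y)"
      and *: "a \<in> carrier cpoly_ring" "x \<in> carrier ?M" "y \<in> carrier ?N"
    have smultM: "a \<odot>\<^bsub>?M\<^esub> x = {j + ?em a * u |j u. j \<in> J \<and> u \<in> x}"
      by (simp add: weyl_poly_quotient_def quotient_restrict_scalars_simps)
    have smultN: "a \<odot>\<^bsub>?N\<^esub> y = {j + a * u |j u. j \<in> I \<and> u \<in> y}"
      by (simp add: cpoly_quotient_def quotient_restrict_scalars_simps)
    have "0 + ?em a * rep x \<in> a \<odot>\<^bsub>?M\<^esub> x" using cosetM(1) * J0 unfolding smultM by blast
    hence "rep (a \<odot>\<^bsub>?M\<^esub> x) \<in> a \<odot>\<^bsub>?M\<^esub> x" by (rule someM)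
    then obtain j u where u: "j \<in> J" "u \<in> x" "rep (a \<odot>\<^bsub>?M\<^esub> x) = j + ?em a * u"
      unfolding smultM by blast
    have "0 + a * rep' y \<in> a \<odot>\<^bsub>?N\<^esub> y" using cosetN(1) * I0 unfolding smultN by blast
    hence "rep' (a \<odot>\<^bsub>?N\<^esub> y) \<in> a \<odot>\<^bsub>?N\<^esub> y" by (rule someN)
    then obtain i w where w: "i \<in> I" "w \<in> y" "rep' (a \<odot>\<^bsub>?N\<^esub> y) = i + a * w"
      unfolding smultN by blast
    have "?em (rep' y) * (j + ?em a * (u - rep x)) \<in> T"
      using cosetM *(2) u(1,2) sub(1) by (intro Tmult Tadd) blast+
    moreover have "?em (i + a * (w - rep' y)) * rep x \<in> T"
      using cosetN *(3) w(1,2) by (intro IT Iadd Imult) blast+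
    ultimately have "?em (rep' y) * (j + ?em a * (u - rep x)) - ?em (i + a * (w - rep' y)) * rep x \<in> T"
      by (rule Tdiff)
    moreover have "?em (rep' y) * (?em a * rep x) = ?em (a * rep' y) * rep x"
      by (simp only: mult.commute[of a] cpoly_embed_mult mult.assoc)
    ultimately show "frag_eval \<phi> c \<in> T"
      by (simp add: c frag_eval_add frag_eval_diff frag_eval_of \<phi>_def u(3) w(3) cpoly_embed_add em_diff
          algebra_simps)
  qed
  have relators: "tensor_relators cpoly_ring ?M ?N \<subseteq> carrier ?F"
  proof
    fix c assume c: "c \<in> tensor_relators cpoly_ring ?M ?N"
    interpret M: module cpoly_ring ?M by (rule module_weyl_poly_quotient[OF J])
    interpret N: module cpoly_ring ?N by (rule module_cpoly_quotient[OF I])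
    from c have "Poly_Mapping.keys c \<subseteq> carrier ?M \<times> carrier ?N"
      unfolding tensor_relators_def by (elim UnE CollectE exE conjE) (simp_all add: keys_diff_subset)
    thus "c \<in> carrier ?F" by (simp add: free_Abelian_group_def)
  qed
  have gen: "frag_eval \<phi> c \<in> T" if "c \<in> generate ?F (tensor_relators cpoly_ring ?M ?N)" for c
    using that
  proof induction
    case (inv c)
    hence "c \<in> carrier ?F" using relators by blast
    hence "inv\<^bsub>?F\<^esub> c = - c"
      unfolding carrier_free_Abelian_group_iff by (rule inv_free_Abelian_group)
    thus ?case using Tneg[OF relator[OF inv]] frag_eval_diff[of \<phi> 0 c] by (simp add: frag_eval_zero)
  next
    case (eng c d)
    thus ?case using Tadd by (simp add: frag_eval_add free_Abelian_group_def)
  qed (simp_all add: relator frag_eval_zero T0 free_Abelian_group_def)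
  \<comment> \<open>The class of 1 tensor 1: its representatives are 1 up to \<open>J\<close> and
    \<open>I\<close>, so \<phi> sends it to 1 modulo \<open>T\<close>.\<close>
  let ?x = "{j + 1 |j. j \<in> J}" and ?y = "{j + 1 |j. j \<in> I}"
  have "(?x, ?y) \<in> carrier ?M \<times> carrier ?N"
    by (auto simp: weyl_poly_quotient_def cpoly_quotient_def quotient_restrict_scalars_simps)
  hence "frag_of (?x, ?y) \<in> generate ?F (tensor_relators cpoly_ring ?M ?N)"
    by (rule tensor_product_trivialD[OF trivial])
  hence "frag_eval \<phi> (frag_of (?x, ?y)) \<in> T" by (rule gen)
  hence T: "?em (rep' ?y) * rep ?x \<in> T" by (simp only: frag_eval_of \<phi>_def case_prod_conv)
  have x: "0 + 1 \<in> ?x" using J0 by blast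
  have y: "0 + 1 \<in> ?y" using I0 by blast
  obtain j where j: "rep ?x = j + 1" "j \<in> J" using someM[OF x] by (elim CollectE exE conjE)
  obtain i where i: "rep' ?y = i + 1" "i \<in> I" using someN[OF y] by (elim CollectE exE conjE)
  have "?em i * (j + 1) + j + 1 \<in> T"
    using T unfolding j(1) i(1) by (simp add: cpoly_embed_add cpoly_embed_one distrib_right add.assoc)
  moreover have "?em i * (j + 1) + j \<in> T"
    using i(2) j(2) sub(1) by (intro Tadd IT) auto
  ultimately have "?em i * (j + 1) + j + 1 - (?em i * (j + 1) + j) \<in> T" by (rule Tdiff)
  hence "1 \<in> T" by simp
  with one show False by simp
qed


section \<open>The ring \<open>D\<^sub>n[s]\<close>\<close>

definition weyl_gens :: "'n + 'n \<Rightarrow> 'n weyl" where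
  "weyl_gens = case_sum weyl_x weyl_d"

text \<open>\<open>Inl\<close> marks the x_i and \<open>Inr\<close> the derivations. Commutators are
  recorded in both orders, hence the entry -1.\<close>

definition weyl_structure :: "'n + 'n \<Rightarrow> 'n + 'n \<Rightarrow> complex" where
  "weyl_structure v w = (case (v, w) of
     (Inr i, Inl j) \<Rightarrow> if i = j then 1 else 0 |
     (Inl i, Inr j) \<Rightarrow> if i = j then - 1 else 0 |
     _ \<Rightarrow> 0)"

lemma weyl_const_uminus: "weyl_const (- a) = - weyl_const a"
  using weyl_const_simps(3)[of a "- a"] by (simp add: eq_neg_iff_add_eq_0 add.commute)

lemma weyl_gens_commutator:
  "weyl_gens v * weyl_gens w = weyl_gens w * weyl_gens v + weyl_const (weyl_structure v w)"
proof -
  have comm: "weyl_d i * weyl_x j = weyl_x j * weyl_d i + (if i = j then 1 else 0)" for i j :: 'a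
    using weyl_relations(3)[of i j] by (simp add: algebra_simps split: if_splits)
  show ?thesis
    by (cases v; cases w)
      (auto simp: weyl_gens_def weyl_structure_def weyl_relations(1,2) comm weyl_const_uminus)
qed

lemma abs_weyl_mult: "abs_weyl (f * g) = abs_weyl f * abs_weyl g"
  by (simp add: times_weyl.abs_eq)

lemma abs_weyl_add: "abs_weyl (f + g) = abs_weyl f + abs_weyl g"
  by (simp add: plus_weyl.abs_eq)

text \<open>Every element is represented by a sum of scaled words, and letters are peeled off on the
  left, matching \<open>gen_mult_Fil\<close>.\<close>

lemma weyl_induct [case_names const gen add]:
  assumes "\<And>a. Q (weyl_const a)" "\<And>g u. Q u \<Longrightarrow> Q (weyl_gens g * u)"
    "\<And>u v. Q u \<Longrightarrow> Q v \<Longrightarrow> Q (u + v)"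
  shows "Q u"
proof -
  have "Q (abs_weyl f)" for f
  proof (induction f rule: poly_mapping_add_induct)
    case (1 w a)
    obtain l where w: "w = Word l" by (cases w)
    show ?case
      unfolding w
    proof (induction l)
      case Nil
      show ?case using assms(1)[of a] by (simp add: weyl_const.abs_eq zero_word_def)
    next
      case (Cons g l)
      have "Poly_Mapping.single (Word (g # l)) a = free_gen g * Poly_Mapping.single (Word l) a"
        by (simp add: free_gen_def Poly_Mapping.mult_single)
      moreover have "abs_weyl (free_gen g) \<in> range weyl_gens"
      proof (cases g)
        case (Gen_x i)
        thus ?thesis by (auto simp: weyl_gens_def weyl_x.abs_eq intro!: image_eqI[of _ _ "Inl i"])
      next
        case (Gen_d i)
        thus ?thesis by (auto simp: weyl_gens_def weyl_d.abs_eq intro!: image_eqI[of _ _ "Inr i"])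
      qed
      ultimately show ?case using assms(2)[OF Cons] by (auto simp: abs_weyl_mult)
    qed
  next
    case (2 f g)
    thus ?case using assms(3) by (simp add: abs_weyl_add)
  qed
  thus ?thesis by (rule weyl.abs_induct)
qed

lemma weyl_poly_specialization_proper:
  fixes J :: "('n::finite, 'p) weyl_poly set" and P :: "'p cpoly set"
  assumes J: "left_ideal J (weyl_poly_ring :: ('n, 'p) weyl_poly ring)"
    and P: "minimal_prime P (cpoly_contraction J) cpoly_ring"
  obtains h where "h \<notin> P"
    "\<And>m. primeideal m cpoly_ring \<Longrightarrow> P \<subseteq> m \<Longrightarrow> h \<notin> m \<Longrightarrow>
       \<exists>T. left_ideal T (weyl_poly_ring :: ('n, 'p) weyl_poly ring) \<and> J \<subseteq> T \<and>
         cpoly_embed ` m \<subseteq> T \<and> 1 \<notin> T"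
proof -
  obtain vs :: "('n + 'n) list" where vs: "distinct vs" "set vs = UNIV"
    using finite_distinct_list[of "UNIV :: ('n + 'n) set"] by auto
  obtain q :: "nat \<Rightarrow> nat" where q: "inj q" "range q \<subseteq> {p. Factorial_Ring.prime p}"
    using infinite_countable_subset[OF primes_infinite] by blast
  obtain i :: "'n + 'n \<Rightarrow> nat" where i: "inj i"
    using finite_imp_inj_to_nat_seg[of "UNIV :: ('n + 'n) set"] by auto
  define p where "p = q \<circ> i"
  have "inj p" unfolding p_def using q(1) i by (rule inj_compose)
  have p_prime: "Factorial_Ring.prime (p v)" for v using q(2) by (auto simp: p_def)
  let ?t = "\<lambda>v. Poly_Mapping.single 0 (weyl_gens v) :: ('n, 'p) weyl_poly"
  interpret central_commutators "cpoly_embed :: 'p cpoly \<Rightarrow> ('n, 'p) weyl_poly" ?t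
    "\<lambda>v w. Poly_Mapping.single 0 (weyl_structure v w)" vs p
  proof
    fix v w
    show "?t v * ?t w = ?t w * ?t v + cpoly_embed (Poly_Mapping.single 0 (weyl_structure v w))"
      by (simp add: Poly_Mapping.mult_single cpoly_embed_single weyl_gens_commutator[of v w]
          flip: single_add)
  qed (rule cpoly_embed_add cpoly_embed_mult cpoly_embed_one cpoly_embed_central vs \<open>inj p\<close> p_prime)+
  have Fil_add': "\<exists>k. u + v \<in> Fil UNIV k" if "\<exists>k. u \<in> Fil UNIV k" "\<exists>k. v \<in> Fil UNIV k" for u v
    using that Fil_add Fil_mono by (metis max.cobounded1 max.cobounded2 subset_refl)
  have em: "cpoly_embed f * u \<in> Fil UNIV k" if "u \<in> Fil UNIV k" for f u k
    using that by (rule Fil_em_mult) simp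
  \<comment> \<open>The empty monomial has weight 1 and the filtration bound is strict, hence level
    2.\<close>
  have one: "1 \<in> Fil UNIV 2"
    using Fil_single[of 1 UNIV "\<lambda>_. 0" 2] by (simp add: nmon_zero weight_zero em_one)
  have weyl: "\<exists>k. Poly_Mapping.single 0 w \<in> Fil UNIV k" for w :: "'n weyl"
  proof (induction w rule: weyl_induct)
    case (const a)
    show ?case
      using em[OF one, of "Poly_Mapping.single 0 a"] by (auto simp: cpoly_embed_single)
  next
    case (gen g w)
    then obtain k where "Poly_Mapping.single 0 w \<in> Fil UNIV k" by blast
    from gen_mult_Fil[OF this, of g] show ?case by (auto simp: Poly_Mapping.mult_single)
  next
    case (add u v)
    thus ?case using Fil_add' by (simp add: single_add)
  qed
  \<comment> \<open>Each term is a central monomial in the s_i times a Weyl algebra element, already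
    known to have an expansion.\<close>
  have "\<exists>k. u \<in> Fil UNIV k" for u
  proof (induction u rule: poly_mapping_add_induct)
    case (1 m w)
    obtain k where "Poly_Mapping.single 0 w \<in> Fil UNIV k" using weyl by blast
    from em[OF this, of "Poly_Mapping.single m 1"] show ?case
      by (auto simp: cpoly_embed_single Poly_Mapping.mult_single)
  qed (rule Fil_add')
  from generic_specialization_proper[OF this J P[unfolded cpoly_contraction_def]] that
  show thesis by blast
qed

theorem theoremB:
  fixes J :: "('n::finite, 'p::finite) weyl_poly set"
    and P :: "'p cpoly set"
  assumes "left_ideal J weyl_poly_ring"
    and "minimal_prime P (cpoly_contraction J) cpoly_ring"
  shows "\<exists>h. h \<notin> P \<and>
    (\<forall>\<alpha> \<in> zero_locus P - zero_locus {h}.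
       carrier (tensor_product cpoly_ring (weyl_poly_quotient J) (cpoly_quotient (point_ideal \<alpha>)))
         \<noteq> {\<one>\<^bsub>tensor_product cpoly_ring (weyl_poly_quotient J) (cpoly_quotient (point_ideal \<alpha>))\<^esub>})"
proof -
  obtain h where h: "h \<notin> P"
    "\<And>m. primeideal m cpoly_ring \<Longrightarrow> P \<subseteq> m \<Longrightarrow> h \<notin> m \<Longrightarrow>
       \<exists>T. left_ideal T (weyl_poly_ring :: ('n, 'p) weyl_poly ring) \<and> J \<subseteq> T \<and>
         cpoly_embed ` m \<subseteq> T \<and> 1 \<notin> T"
    using weyl_poly_specialization_proper[OF assms] by blast
  show ?thesis
  proof (intro exI conjI ballI)
    show "h \<notin> P" by (rule h(1))
    fix \<alpha> assume "\<alpha> \<in> zero_locus P - zero_locus {h}"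
    \<comment> \<open>The geometric condition on \<alpha> becomes the condition on primes over
      \<open>P\<close> in the specialization result.\<close>
    hence "P \<subseteq> point_ideal \<alpha>" "h \<notin> point_ideal \<alpha>"
      by (auto simp: zero_locus_def point_ideal_def)
    then obtain T where "left_ideal T (weyl_poly_ring :: ('n, 'p) weyl_poly ring)" "J \<subseteq> T"
      "cpoly_embed ` point_ideal \<alpha> \<subseteq> T" "1 \<notin> T"
      using h(2)[OF primeideal_point_ideal] by blast
    thus "carrier (tensor_product cpoly_ring (weyl_poly_quotient J) (cpoly_quotient (point_ideal \<alpha>)))
      \<noteq> {\<one>\<^bsub>tensor_product cpoly_ring (weyl_poly_quotient J) (cpoly_quotient (point_ideal \<alpha>))\<^esub>}"
      using assms(1) primeideal.axioms(1)[OF primeideal_point_ideal]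
      by (intro tensor_product_nontrivial)
  qed
qed

end
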